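(* Suppose $(W_t,\mathcal{F}_t)_{t\ge0}$ is an $N$-dimensional Brownian motion, and $Z$ is a $D$-dimensional $(\mathcal{F}_t)$-adapted process independent of $W$ which is $\alpha$-Hölder continuous on compacts for some $\alpha>1/2$. Further assume that the matrix $\sigma\sigma^*$ is strictly positive definite, where $\sigma=(\sigma_{d,\nu})_{d=1,\ldots,D,\ \nu=1,\ldots,N}$ is a constant real matrix. Define $D$ stocks by $$X^d_t=x^d_0\exp\Big\{\sum_{\nu=1}^N\sigma_{d,\nu}W^\nu_t+Z^d_t\Big\},\qquad d=1,\ldots,D,$$ with constant initial values $x_0^d>0$. Then the $D$-dimensional mixed Black–Scholes model $X_t=(X^1_t,\ldots,X^D_t)^*$ is free of simple arbitrage on finite time horizons.
   Context: Setting: $(\Omega,\mathcal{F},(\mathcal{F}_t)_{t\in[0,\infty)},P)$ is a filtered probability space satisfying the usual conditions (completeness and right-continuity). "$(W_t,\mathcal{F}_t)$ is a Brownian motion" means that $W$ is a Brownian motion with respect to the filtration $(\mathcal{F}_t)$. The superscript $*$ denotes transposition. A process $Z$ is $\alpha$-Hölder continuous on compacts if for every $K\in\mathbb{N}$ there is a positive random variable $C_K$ with $|Z_t-Z_s|\le C_K|t-s|^{\alpha}$ for all $0\le s\le t\le K$. For an adapted, right-continuous $\mathbb{R}^D$-valued process $X$ (discounted stock prices, with constant bond $1$) on a filtration $(\mathcal{G}_t)$, a simple strategy is $\Phi_t=\phi_0\mathbf{1}_{\{0\}}(t)+\sum_{j=0}^{n-1}\phi_j\mathbf{1}_{(\tau_j,\tau_{j+1}]}(t)$,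 where $n\in\mathbb{N}$, $0=\tau_0\le\tau_1\le\cdots\le\tau_n$ are a.s. finite $(\mathcal{G}_t)$-stopping times and each $\phi_j$ is a $D$-dimensional row vector of $\mathcal{G}_{\tau_j}$-measurable random variables. Its terminal wealth with zero initial capital is $V_\infty(\Phi;0)=\sum_{j=0}^{n-1}\phi_j(X_{\tau_{j+1}}-X_{\tau_j})$. It is a simple arbitrage if $V_\infty(\Phi;0)\ge0$ $P$-a.s. and $P(V_\infty(\Phi;0)>0)>0$. A model $(X_t,\mathcal{F}_t)$ is free of simple arbitrage on finite time horizons if for every $T>0$ the stopped model $(X_{t\wedge T},\mathcal{F}_{t\wedge T})_{t\ge0}$ has no simple arbitrage. *)

theory Defs
  imports "HOL-Probability.Probability"
begin

text \<open>
  Processes are indexed by \<^typ>\<open>real\<close> and only used at times \<open>t \<ge> 0\<close>. Filtrations are indexed by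
  \<^typ>\<open>ennreal\<close>, so that the library notions \<^const>\<open>stopping_time\<close> and
  \<^const>\<open>filtration.pre_sigma\<close> apply to stopping times with values in \<open>[0,\<infinity>]\<close>; the additional
  member \<open>F \<infinity>\<close> may be any sub-\<open>\<sigma>\<close>-algebra of \<open>M\<close> containing all \<open>F t\<close>. Only the \<open>\<sigma>\<close>-algebras
  of the measures \<open>F t\<close> are relevant.
\<close>

locale usual_filtered_prob_space =
  prob_space M + complete_measure M + filtration "space M" F
  for M :: "'a measure" and F :: "ennreal \<Rightarrow> 'a measure" +
  assumes sets_F_subset: "sets (F t) \<subseteq> sets M"
    and null_sets_F_0: "null_sets M \<subseteq> sets (F 0)"
    and right_continuous_F: "t < \<infinity> \<Longrightarrow> sets (F t) = (\<Inter>s\<in>{t<..}. sets (F s))"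

definition adapted ::
  "(ennreal \<Rightarrow> 'a measure) \<Rightarrow> (real \<Rightarrow> 'a \<Rightarrow> 'b::topological_space) \<Rightarrow> bool" where
  "adapted F X \<longleftrightarrow> (\<forall>t\<ge>0. X t \<in> borel_measurable (F (ennreal t)))"

text \<open>Standard \<open>N\<close>-dimensional Brownian motion with respect to \<open>F\<close>: the increment over \<open>[s,t]\<close> is
  independent of \<open>F s\<close> and has law \<open>N(0, (t - s) I)\<close>. (The second parameter of
  \<^const>\<open>normal_density\<close> is the standard deviation.)\<close>

definition brownian_motion ::
  "'a measure \<Rightarrow> (ennreal \<Rightarrow> 'a measure) \<Rightarrow> (real \<Rightarrow> 'a \<Rightarrow> real ^ 'n) \<Rightarrow> bool" where
  "brownian_motion M F W \<longleftrightarrow>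
     adapted F W \<and>
     (AE \<omega> in M. W 0 \<omega> = 0) \<and>
     (AE \<omega> in M. continuous_on {0..} (\<lambda>t. W t \<omega>)) \<and>
     (\<forall>s\<ge>0. \<forall>t>s.
        prob_space.indep_set M (sets (F (ennreal s)))
          (sets (vimage_algebra (space M) (\<lambda>\<omega>. W t \<omega> - W s \<omega>) borel)) \<and>
        distributed M lborel (\<lambda>\<omega>. W t \<omega> - W s \<omega>)
          (\<lambda>x. ennreal (\<Prod>\<nu>\<in>UNIV. normal_density 0 (sqrt (t - s)) (x $ \<nu>))))"

text \<open>The \<open>\<sigma>\<close>-algebra on \<open>\<Omega>\<close> generated by all \<open>Y t\<close> with \<open>t \<ge> 0\<close>.\<close>

definition generated_by ::
  "'a set \<Rightarrow> (real \<Rightarrow> 'a \<Rightarrow> 'b::topological_space) \<Rightarrow> 'a measure" where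
  "generated_by \<Omega> Y =
     vimage_algebra \<Omega> (\<lambda>\<omega>. \<lambda>t\<in>{0..}. Y t \<omega>) (PiM {0..} (\<lambda>_. borel))"

definition independent_processes ::
  "'a measure \<Rightarrow> (real \<Rightarrow> 'a \<Rightarrow> 'b::topological_space) \<Rightarrow>
     (real \<Rightarrow> 'a \<Rightarrow> 'c::topological_space) \<Rightarrow> bool" where
  "independent_processes M Y Z \<longleftrightarrow>
     prob_space.indep_set M (sets (generated_by (space M) Y)) (sets (generated_by (space M) Z))"

definition holder_on_compacts ::
  "'a measure \<Rightarrow> real \<Rightarrow> (real \<Rightarrow> 'a \<Rightarrow> 'b::real_normed_vector) \<Rightarrow> bool" where
  "holder_on_compacts M \<alpha> Z \<longleftrightarrow>
     (\<forall>K::nat. \<exists>C \<in> borel_measurable M. (\<forall>\<omega>\<in>space M. 0 < C \<omega>) \<and>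
        (AE \<omega> in M. \<forall>s t. 0 \<le> s \<and> s \<le> t \<and> t \<le> real K \<longrightarrow>
           norm (Z t \<omega> - Z s \<omega>) \<le> C \<omega> * \<bar>t - s\<bar> powr \<alpha>))"

definition strictly_positive_definite :: "real ^ 'd ^ 'd \<Rightarrow> bool" where
  "strictly_positive_definite A \<longleftrightarrow> transpose A = A \<and> (\<forall>v. v \<noteq> 0 \<longrightarrow> 0 < v \<bullet> (A *v v))"

text \<open>A simple strategy
  \<open>\<phi> 0 \<cdot> 1\<^bsub>{0}\<^esub> + (\<Sum>j<n. \<phi> j \<cdot> 1\<^bsub>(\<tau> j, \<tau> (j+1)]\<^esub>)\<close> is given by its data \<open>n\<close>, \<open>\<tau>\<close>, \<open>\<phi>\<close>;
  only \<open>\<tau> 0, \<dots>, \<tau> n\<close> and \<open>\<phi> 0, \<dots>, \<phi> (n-1)\<close> matter.\<close>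

definition simple_strategy ::
  "'a measure \<Rightarrow> (ennreal \<Rightarrow> 'a measure) \<Rightarrow>
     nat \<Rightarrow> (nat \<Rightarrow> 'a \<Rightarrow> ennreal) \<Rightarrow> (nat \<Rightarrow> 'a \<Rightarrow> real ^ 'd) \<Rightarrow> bool" where
  "simple_strategy M G n \<tau> \<phi> \<longleftrightarrow>
     (\<forall>j\<le>n. stopping_time G (\<tau> j) \<and> (AE \<omega> in M. \<tau> j \<omega> < \<infinity>)) \<and>
     (\<forall>\<omega>\<in>space M. \<tau> 0 \<omega> = 0 \<and> (\<forall>j<n. \<tau> j \<omega> \<le> \<tau> (Suc j) \<omega>)) \<and>
     (\<forall>j<n. \<phi> j \<in> borel_measurable (filtration.pre_sigma (space M) G (\<tau> j)))"

text \<open>Terminal wealth with zero initial capital. The value of \<^const>\<open>enn2real\<close> at \<open>\<infinity>\<close> only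
  affects a null set, the stopping times being almost surely finite.\<close>

definition terminal_wealth ::
  "(real \<Rightarrow> 'a \<Rightarrow> real ^ 'd) \<Rightarrow>
     nat \<Rightarrow> (nat \<Rightarrow> 'a \<Rightarrow> ennreal) \<Rightarrow> (nat \<Rightarrow> 'a \<Rightarrow> real ^ 'd) \<Rightarrow> 'a \<Rightarrow> real" where
  "terminal_wealth X n \<tau> \<phi> \<omega> =
     (\<Sum>j<n. \<phi> j \<omega> \<bullet> (X (enn2real (\<tau> (Suc j) \<omega>)) \<omega> - X (enn2real (\<tau> j \<omega>)) \<omega>))"

definition simple_arbitrage ::
  "'a measure \<Rightarrow> (ennreal \<Rightarrow> 'a measure) \<Rightarrow> (real \<Rightarrow> 'a \<Rightarrow> real ^ 'd) \<Rightarrow>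
     nat \<Rightarrow> (nat \<Rightarrow> 'a \<Rightarrow> ennreal) \<Rightarrow> (nat \<Rightarrow> 'a \<Rightarrow> real ^ 'd) \<Rightarrow> bool" where
  "simple_arbitrage M G X n \<tau> \<phi> \<longleftrightarrow>
     simple_strategy M G n \<tau> \<phi> \<and>
     (AE \<omega> in M. 0 \<le> terminal_wealth X n \<tau> \<phi> \<omega>) \<and>
     0 < measure M {\<omega>\<in>space M. 0 < terminal_wealth X n \<tau> \<phi> \<omega>}"

definition free_of_simple_arbitrage_on_finite_horizons ::
  "'a measure \<Rightarrow> (ennreal \<Rightarrow> 'a measure) \<Rightarrow> (real \<Rightarrow> 'a \<Rightarrow> real ^ 'd) \<Rightarrow> bool" where
  "free_of_simple_arbitrage_on_finite_horizons M F X \<longleftrightarrow>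
     (\<forall>T>0. \<not> (\<exists>n \<tau> \<phi>. simple_arbitrage M
        (\<lambda>t. F (min t (ennreal T))) (\<lambda>t. X (min t T)) n \<tau> \<phi>))"

definition mixed_black_scholes ::
  "real ^ 'd \<Rightarrow> real ^ 'n ^ 'd \<Rightarrow> (real \<Rightarrow> 'a \<Rightarrow> real ^ 'n) \<Rightarrow> (real \<Rightarrow> 'a \<Rightarrow> real ^ 'd) \<Rightarrow>
     real \<Rightarrow> 'a \<Rightarrow> real ^ 'd" where
  "mixed_black_scholes x0 \<sigma> W Z t \<omega> =
     (\<chi> d. x0 $ d * exp ((\<Sum>\<nu>\<in>UNIV. \<sigma> $ d $ \<nu> * W t \<omega> $ \<nu>) + Z t \<omega> $ d))"

end

theory Submission
  imports Defs
begin

text \<open>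
  With a right inverse \<open>R\<close> of \<open>\<sigma>\<close>, the log prices are \<open>\<sigma> Y\<close> for \<open>Y = W + R Z\<close>, up to constants. Two
  path properties of \<open>Y\<close> exclude arbitrage. Stickiness: from any time \<open>s\<close> on and conditionally on
  any event of \<open>F s\<close>, \<open>Y\<close> stays near \<open>Y s\<close> up to a given horizon with positive probability. Two-way
  crossing: right after a stopping time, the increments of \<open>W\<close> over a time \<open>h\<close> are of order \<open>\<surd>h\<close> with
  any prescribed signs for arbitrarily small \<open>h\<close>, while those of \<open>Z\<close> are \<open>o(\<surd>h)\<close> because
  \<open>\<alpha> > 1 / 2\<close>. By stickiness, nonnegative terminal wealth forces the wealth to be nonnegative
  throughout the last trading period; by induction it vanishes at the start of that period, and then
  two-way crossing shows that nothing is held during it.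

  Since \<open>F\<close> may be larger than the filtration generated by \<open>W\<close> and \<open>Z\<close>, the future of \<open>Z\<close> need not be
  independent of the future of \<open>W\<close> given \<open>F s\<close>, so stickiness does not follow by conditioning on
  \<open>Z\<close>. Instead, \<open>W\<close> is steered towards \<open>Y = Y s\<close> on a fine grid by a change of measure whose density
  has expectation \<open>1\<close> given \<open>F s\<close>, by the Markov property of \<open>W\<close>, and also given \<open>Z\<close>, by independence.
  Hence it preserves both the probability of an event \<open>A\<close> of \<open>F s\<close> and the small probability that
  \<open>Z\<close> oscillates too much on the grid; if the latter is less than \<open>P(A)\<close>, the steering succeeds on
  a part of \<open>A\<close> of positive probability.
\<close>

section \<open>Steering by a change of measure\<close>

text \<open>
  In step \<open>k\<close> the event \<open>e k (v k \<omega>)\<close> is forced. The value \<open>steered m B\<close> is the integral over \<open>B\<close> of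
  the density \<open>\<Prod>k<m. 1\<^bsub>e k (v k)\<^esub> / P(e k (v k))\<close>.
\<close>

locale steering = prob_space M for M :: "'a measure" +
  fixes v :: "nat \<Rightarrow> 'a \<Rightarrow> 'v::finite" and e :: "nat \<Rightarrow> 'v \<Rightarrow> 'a set" and n :: nat
  assumes v_events [measurable]: "k < n \<Longrightarrow> {\<omega>\<in>space M. v k \<omega> = x} \<in> events"
    and e_events [measurable]: "k < n \<Longrightarrow> e k x \<in> events"
    and e_pos: "k < n \<Longrightarrow> 0 < prob (e k x)"
begin

primrec steered :: "nat \<Rightarrow> 'a set \<Rightarrow> real" where
  "steered 0 B = prob B"
| "steered (Suc m) B =
     (\<Sum>x\<in>UNIV. steered m (B \<inter> {\<omega>\<in>space M. v m \<omega> = x} \<inter> e m x) / prob (e m x))"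

lemma steered_nonneg: "0 \<le> steered m B"
  by (induction m arbitrary: B) (auto intro!: sum_nonneg divide_nonneg_nonneg)

lemma steered_Un:
  assumes "m \<le> n" "B \<in> events" "C \<in> events" "B \<inter> C = {}"
  shows "steered m (B \<union> C) = steered m B + steered m C"
  using assms
proof (induction m arbitrary: B C)
  case 0
  then show ?case by (simp add: finite_measure_Union)
next
  case (Suc m)
  have "steered m ((B \<union> C) \<inter> {\<omega>\<in>space M. v m \<omega> = x} \<inter> e m x) =
      steered m (B \<inter> {\<omega>\<in>space M. v m \<omega> = x} \<inter> e m x) +
      steered m (C \<inter> {\<omega>\<in>space M. v m \<omega> = x} \<inter> e m x)" for x
    using Suc.prems
    by (subst Suc.IH[symmetric]) (auto simp: Int_Un_distrib2 intro!: sets.Int v_events e_events)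
  then show ?case
    by (simp add: add_divide_distrib sum.distrib)
qed

text \<open>Total probability for the weight \<open>steered m\<close>. Only binary additivity is at
  hand, so the level sets of \<open>u\<close> are added one value at a time.\<close>

lemma steered_Int_sum:
  assumes "m \<le> n" "B \<in> events" "\<And>x. {\<omega>\<in>space M. u \<omega> = x} \<in> events"
  shows "(\<Sum>x\<in>UNIV. steered m (B \<inter> {\<omega>\<in>space M. u \<omega> = (x::'v)})) = steered m B"
proof -
  have empty: "steered m {} = 0"
    using steered_Un[of m "{}" "{}"] assms by simp
  have "(\<Sum>x\<in>S. steered m (B \<inter> {\<omega>\<in>space M. u \<omega> = x})) = steered m (B \<inter> {\<omega>\<in>space M. u \<omega> \<in> S})
        \<and> {\<omega>\<in>space M. u \<omega> \<in> S} \<in> events"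
    if "finite S" for S
    using that
  proof induction
    case (insert x S)
    have eq: "{\<omega>\<in>space M. u \<omega> \<in> insert x S} = {\<omega>\<in>space M. u \<omega> = x} \<union> {\<omega>\<in>space M. u \<omega> \<in> S}"
      by auto
    have "steered m (B \<inter> {\<omega>\<in>space M. u \<omega> = x} \<union> B \<inter> {\<omega>\<in>space M. u \<omega> \<in> S}) =
        steered m (B \<inter> {\<omega>\<in>space M. u \<omega> = x}) + steered m (B \<inter> {\<omega>\<in>space M. u \<omega> \<in> S})"
      using insert assms by (intro steered_Un) auto
    then show ?case
      using insert assms(3) unfolding eq by (auto simp: Int_Un_distrib)
  qed (auto simp: empty)
  from this[of UNIV] show ?thesis
    using sets.sets_into_space[OF assms(2)] by (simp add: Int_absorb2)
qed

lemma steered_split: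
  assumes "m \<le> n" "B \<in> events" "C \<in> events"
  shows "steered m B \<le> steered m (B - C) + steered m C"
proof -
  have "steered m B = steered m (B - C) + steered m (B \<inter> C)"
    using assms by (subst steered_Un[symmetric]) (auto simp: Un_Diff_Int)
  moreover have "steered m C = steered m (C - B) + steered m (C \<inter> B)"
    using assms by (subst steered_Un[symmetric]) (auto simp: Un_Diff_Int)
  ultimately show ?thesis
    using steered_nonneg[of m "C - B"] by (simp add: Int_commute)
qed

text \<open>The density vanishes wherever some forced event fails. No measurability of
  \<open>B\<close> is assumed: \<open>prob\<close> is 0 outside \<open>events\<close>, so the base
  case covers every set that is avoided almost surely.\<close>

lemma steered_null:
  assumes "m \<le> n" "AE \<omega> in M. \<omega> \<in> B \<longrightarrow> (\<exists>k<m. \<omega> \<notin> e k (v k \<omega>))"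
  shows "steered m B = 0"
  using assms
proof (induction m arbitrary: B)
  case 0
  then have "AE \<omega> in M. \<omega> \<notin> B" by simp
  then show ?case
    by (cases "B \<in> events") (auto simp: prob_eq_0 measure_notin_sets)
next
  case (Suc m)
  \<comment> \<open>On this piece the event forced in step \<open>m\<close> occurs, so the failure
    must happen at some \<open>k < m\<close>.\<close>
  have "steered m (B \<inter> {\<omega>\<in>space M. v m \<omega> = x} \<inter> e m x) = 0" for x
    using Suc.prems by (intro Suc.IH) (auto simp: less_Suc_eq)
  then show ?case by simp
qed

text \<open>Martingale property: given \<open>G k\<close>, the density factor of step
  \<open>k\<close> has expectation 1, because the choice \<open>v k\<close> is known in
  \<open>G k\<close> and each candidate event is independent of \<open>G k\<close>. The families
  \<open>G k\<close> are abstract since the result is applied along two different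
  filtrations.\<close>

lemma steered_eq_prob:
  fixes G :: "nat \<Rightarrow> 'a set set"
  assumes G_events: "\<And>k. G k \<subseteq> events"
    and G_mono: "\<And>k. G k \<subseteq> G (Suc k)"
    and G_Int: "\<And>k A B. A \<in> G k \<Longrightarrow> B \<in> G k \<Longrightarrow> A \<inter> B \<in> G k"
    and v_G: "\<And>k x. k < n \<Longrightarrow> {\<omega>\<in>space M. v k \<omega> = x} \<in> G k"
    and e_G: "\<And>k x. k < n \<Longrightarrow> e k x \<in> G (Suc k)"
    and indep: "\<And>k x C. k < n \<Longrightarrow> C \<in> G k \<Longrightarrow> prob (C \<inter> e k x) = prob C * prob (e k x)"
    and "m \<le> n" "B \<in> G 0"
  shows "steered m B = prob B"
proof -
  have mono: "i \<le> j \<Longrightarrow> A \<in> G i \<Longrightarrow> A \<in> G j" for i j A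
    using lift_Suc_mono_le[of G i j] G_mono by blast
  \<comment> \<open>Independence of \<open>e k x\<close> from \<open>G k\<close> passes from
    \<open>prob\<close> to \<open>steered j\<close> for \<open>j \<le> k\<close>: the earlier
    density factors are determined within \<open>G k\<close>, so unfolding them keeps the event in
    \<open>G k\<close>.\<close>
  have step: "steered j (C \<inter> e k x) = steered j C * prob (e k x)"
    if "k < n" "j \<le> k" "C \<in> G k" for j k x C
    using that(2,3)
  proof (induction j arbitrary: C)
    case 0
    then show ?case using indep that by simp
  next
    case (Suc j)
    have "C \<inter> {\<omega>\<in>space M. v j \<omega> = y} \<inter> e j y \<in> G k" for y
      using Suc.prems \<open>k < n\<close> by (intro G_Int mono[OF _ v_G] mono[OF _ e_G]) auto
    from Suc.IH[OF _ this] Suc.prems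
    have "steered j (C \<inter> {\<omega>\<in>space M. v j \<omega> = y} \<inter> e j y \<inter> e k x) =
      steered j (C \<inter> {\<omega>\<in>space M. v j \<omega> = y} \<inter> e j y) * prob (e k x)" for y
      by simp
    moreover have "C \<inter> e k x \<inter> {\<omega>\<in>space M. v j \<omega> = y} \<inter> e j y =
      C \<inter> {\<omega>\<in>space M. v j \<omega> = y} \<inter> e j y \<inter> e k x" for y
      by auto
    ultimately show ?case
      by (simp add: sum_distrib_right)
  qed
  show ?thesis
    using \<open>m \<le> n\<close>
  proof (induction m)
    case (Suc m)
    have "B \<inter> {\<omega>\<in>space M. v m \<omega> = x} \<in> G m" for x
      using Suc.prems \<open>B \<in> G 0\<close> by (intro G_Int v_G) (auto intro: mono[of 0 m])
    then have "steered (Suc m) B = (\<Sum>x\<in>UNIV. steered m (B \<inter> {\<omega>\<in>space M. v m \<omega> = x}))"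
      using Suc.prems e_pos[of m, THEN less_imp_neq] by (auto simp: step intro!: sum.cong)
    also have "\<dots> = steered m B"
      using Suc.prems \<open>B \<in> G 0\<close> G_events by (intro steered_Int_sum v_events) auto
    finally show ?case using Suc by simp
  qed simp
qed

end

section \<open>Increments of Brownian motion\<close>

text \<open>For \<open>r > 0\<close>, a closed cube of side \<open>r\<close> at distance
  \<open>r\<close> from every coordinate hyperplane, in the orthant with signs \<open>x\<close>. The
  inner bound forces a move in the prescribed direction, the outer bound limits its size, and
  closedness makes the box survive limits of increments.\<close>

definition signed_box :: "real \<Rightarrow> ('n \<Rightarrow> bool) \<Rightarrow> (real ^ 'n) set" where
  "signed_box r x = {y. \<forall>\<nu>. if x \<nu> then r \<le> y $ \<nu> \<and> y $ \<nu> \<le> 2 * r else - 2 * r \<le> y $ \<nu> \<and> y $ \<nu> \<le> - r}"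

lemma signed_box_eq_cbox:
  "signed_box r x = cbox (\<chi> \<nu>. if x \<nu> then r else - 2 * r) (\<chi> \<nu>. if x \<nu> then 2 * r else - r)"
  unfolding signed_box_def by (rule set_eqI) (simp add: mem_box_cart if_distrib)

lemma closed_signed_box [simp]: "closed (signed_box r x)"
  unfolding signed_box_eq_cbox by (rule closed_cbox)

lemma signed_box_borel [measurable]: "signed_box r x \<in> sets borel"
  by (simp add: borel_closed)

lemma emeasure_signed_box:
  fixes x :: "'n::finite \<Rightarrow> bool"
  assumes "0 < r"
  shows "emeasure lborel (signed_box r x) = ennreal (r ^ CARD('n))"
proof -
  have "measure lborel (signed_box r x) =
      (\<Prod>\<nu>\<in>UNIV. (if x \<nu> then 2 * r else - r) - (if x \<nu> then r else - 2 * r))"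
    unfolding signed_box_eq_cbox using assms
    by (subst content_cbox_cart) (auto simp: interval_eq_empty_cart)
  also have "\<dots> = (\<Prod>\<nu>\<in>(UNIV::'n set). r)"
    by (intro prod.cong) auto
  finally have "measure lborel (signed_box r x) = r ^ CARD('n)"
    by simp
  moreover have "emeasure lborel (signed_box r x) < \<infinity>"
    unfolding signed_box_eq_cbox by (simp add: emeasure_lborel_cbox_eq)
  ultimately show ?thesis
    by (simp add: emeasure_eq_ennreal_measure less_top)
qed

lemma signed_box_bounds:
  assumes "y \<in> signed_box r x" "0 \<le> r"
  shows "x \<nu> \<Longrightarrow> r \<le> y $ \<nu>" "\<not> x \<nu> \<Longrightarrow> y $ \<nu> \<le> - r" "\<bar>y $ \<nu>\<bar> \<le> 2 * r"
  using assms unfolding signed_box_def by (auto simp: abs_le_iff dest!: spec[of _ \<nu>] split: if_splits)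

text \<open>Brownian scaling: with \<open>r = sqrt (t - s)\<close> the density of the increment on
  the box is at least \<open>(normal_density 0 1 2 / r) ^ CARD('n)\<close>, and the box has volume
  \<open>r ^ CARD('n)\<close>. The powers of \<open>r\<close> cancel, so \<open>q\<close> depends
  neither on the times nor on the signs.\<close>

lemma brownian_increment_signed_box:
  fixes W :: "real \<Rightarrow> 'a \<Rightarrow> real ^ 'n"
  assumes "prob_space M" "brownian_motion M F W"
  obtains q where "0 < q"
    "\<And>s t x. 0 \<le> s \<Longrightarrow> s < t \<Longrightarrow>
       q \<le> measure M {\<omega>\<in>space M. W t \<omega> - W s \<omega> \<in> signed_box (sqrt (t - s)) x}"
proof
  interpret prob_space M by fact
  let ?q = "normal_density 0 1 2 ^ CARD('n)"
  show "0 < ?q" by (simp add: normal_density_pos)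
  fix s t :: real and x :: "'n \<Rightarrow> bool"
  assume "0 \<le> s" "s < t"
  define r where "r = sqrt (t - s)"
  have "0 < r" using \<open>s < t\<close> by (simp add: r_def)
  let ?f = "\<lambda>y::real^'n. ennreal (\<Prod>\<nu>\<in>UNIV. normal_density 0 r (y $ \<nu>))"
  have D: "distributed M lborel (\<lambda>\<omega>. W t \<omega> - W s \<omega>) ?f"
    using assms(2) \<open>0 \<le> s\<close> \<open>s < t\<close> unfolding brownian_motion_def r_def by blast
  have *: "normal_density 0 1 2 / r \<le> normal_density 0 r z" if "\<bar>z\<bar> \<le> 2 * r" for z
  proof -
    have "z\<^sup>2 \<le> (2 * r)\<^sup>2"
      using that by (metis abs_le_square_iff abs_of_nonneg abs_ge_zero order_trans)
    then have "- 2 \<le> - z\<^sup>2 / (2 * r\<^sup>2)"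
      using \<open>0 < r\<close> by (simp add: field_simps power2_eq_square)
    then show ?thesis
      using \<open>0 < r\<close> unfolding normal_density_def by (simp add: real_sqrt_mult field_simps)
  qed
  have "ennreal ?q = ennreal ((normal_density 0 1 2 / r) ^ CARD('n)) * emeasure lborel (signed_box r x)"
    using \<open>0 < r\<close> by (simp add: emeasure_signed_box ennreal_mult[symmetric] power_divide)
  also have "\<dots> = (\<integral>\<^sup>+y. ennreal ((normal_density 0 1 2 / r) ^ CARD('n)) * indicator (signed_box r x) y \<partial>lborel)"
    by (simp add: nn_integral_cmult)
  also have "\<dots> \<le> (\<integral>\<^sup>+y. ?f y * indicator (signed_box r x) y \<partial>lborel)"
  proof (intro nn_integral_mono)
    fix y
    have "(normal_density 0 1 2 / r) ^ CARD('n) \<le> (\<Prod>\<nu>\<in>UNIV. normal_density 0 r (y $ \<nu>))"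
      if "y \<in> signed_box r x"
    proof -
      have "(\<Prod>\<nu>\<in>(UNIV::'n set). normal_density 0 1 2 / r) \<le> (\<Prod>\<nu>\<in>UNIV. normal_density 0 r (y $ \<nu>))"
        using \<open>0 < r\<close> signed_box_bounds(3)[OF that] by (intro prod_mono) (auto intro!: *)
      then show ?thesis by simp
    qed
    then show "ennreal ((normal_density 0 1 2 / r) ^ CARD('n)) * indicator (signed_box r x) y
        \<le> ?f y * indicator (signed_box r x) y"
      by (auto split: split_indicator intro: ennreal_leI)
  qed
  also have "\<dots> = emeasure M ((\<lambda>\<omega>. W t \<omega> - W s \<omega>) -` signed_box r x \<inter> space M)"
    by (rule distributed_emeasure[OF D, symmetric]) simp
  finally show "?q \<le> prob {\<omega>\<in>space M. W t \<omega> - W s \<omega> \<in> signed_box (sqrt (t - s)) x}"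
    by (simp add: emeasure_eq_measure vimage_def Int_def conj_commute r_def)
qed

section \<open>Upper limits of events\<close>

context prob_space
begin

lemma prob_tendsto_0_if_eventually_notin:
  assumes E: "\<And>j. E j \<in> events"
    and ev: "AE \<omega> in M. eventually (\<lambda>j. \<omega> \<notin> E j) sequentially"
  shows "(\<lambda>j. prob (E j)) \<longlonglongrightarrow> 0"
proof -
  have "(\<lambda>j. \<integral>\<omega>. indicat_real (E j) \<omega> \<partial>M) \<longlonglongrightarrow> (\<integral>\<omega>. 0 \<partial>M)"
  proof (rule integral_dominated_convergence[where w="\<lambda>_. 1"])
    show "AE \<omega> in M. (\<lambda>j. indicat_real (E j) \<omega>) \<longlonglongrightarrow> 0"
      using ev by eventually_elim (rule tendsto_eventually, auto elim: eventually_mono)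
  qed (use E in \<open>auto simp: indicator_def\<close>)
  then show ?thesis
    using E sets.sets_into_space by (simp add: Int_absorb2)
qed

text \<open>A form of the reverse Fatou lemma. A point outside the limit superior lies in only
  finitely many \<open>E j\<close>, so the part of \<open>E j\<close> outside it has probability
  tending to 0, and the bound \<open>c\<close> must be carried by the limit superior itself.\<close>

lemma prob_frequently_ge:
  assumes E: "\<And>j. E j \<in> events" and c: "\<And>j. c \<le> prob (E j)"
  shows "{\<omega>\<in>space M. \<exists>\<^sub>F j in sequentially. \<omega> \<in> E j} \<in> events"
    and "c \<le> prob {\<omega>\<in>space M. \<exists>\<^sub>F j in sequentially. \<omega> \<in> E j}" (is "c \<le> prob ?L")
proof -
  have "?L = (\<Inter>n. \<Union>j\<in>{n..}. E j)"
    using sets.sets_into_space[OF E] by (fastforce simp: frequently_sequentially)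
  also have "\<dots> \<in> events"
    using E by (intro sets.countable_INT sets.countable_UN') auto
  finally show L: "?L \<in> events" .
  have "(\<lambda>j. prob (E j - ?L)) \<longlonglongrightarrow> 0"
    using E L by (intro prob_tendsto_0_if_eventually_notin)
      (auto simp: frequently_def elim: eventually_mono)
  then have "(\<lambda>j. prob ?L + prob (E j - ?L)) \<longlonglongrightarrow> prob ?L + 0"
    by (intro tendsto_intros)
  moreover have "c \<le> prob ?L + prob (E j - ?L)" for j
  proof -
    have "prob (E j) \<le> prob (?L \<union> (E j - ?L))"
      using E L by (intro finite_measure_mono) auto
    also have "\<dots> \<le> prob ?L + prob (E j - ?L)"
      using E L by (intro measure_Un_le) auto
    finally show ?thesis using c[of j] by simp
  qed
  ultimately show "c \<le> prob ?L"
    using LIMSEQ_le_const[of _ "prob ?L + 0" c] by auto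
qed

end

section \<open>The \<sigma>-algebra generated by a process\<close>

lemma measurable_generated_by:
  assumes "0 \<le> t"
  shows "Y t \<in> borel_measurable (generated_by \<Omega> Y)"
proof -
  have "(\<lambda>f. f t) \<circ> (\<lambda>\<omega>. \<lambda>t\<in>{0..}. Y t \<omega>) \<in> borel_measurable (generated_by \<Omega> Y)"
    unfolding generated_by_def using assms
    by (intro measurable_comp[OF measurable_vimage_algebra1] measurable_component_singleton)
      (auto simp: space_PiM PiE_def)
  then show ?thesis
    using assms by (simp add: comp_def)
qed

lemma space_generated_by [simp]: "space (generated_by \<Omega> Y) = \<Omega>"
  by (simp add: generated_by_def)

text \<open>This lets a Borel image of a process inherit independence; it is applied to a linear
  image of \<open>Z\<close>.\<close>

lemma sets_generated_by_comp_subset: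
  assumes g: "g \<in> borel_measurable borel"
  shows "sets (generated_by \<Omega> (\<lambda>t \<omega>. g (Y t \<omega>))) \<subseteq> sets (generated_by \<Omega> Y)"
proof -
  have "(\<lambda>\<omega>. \<lambda>t\<in>{0..}. g (Y t \<omega>)) \<in> measurable (generated_by \<Omega> Y) (PiM {0..} (\<lambda>_. borel))"
    by (intro measurable_restrict measurable_compose[OF _ g] measurable_generated_by) simp
  then show ?thesis
    unfolding generated_by_def[of _ "\<lambda>t \<omega>. g (Y t \<omega>)"]
    using sets_image_in_sets[of "generated_by \<Omega> Y" \<Omega>] by simp
qed

section \<open>Control of paths on a grid and between grid points\<close>

lemma dyadic_floor_tendsto:
  fixes x :: real
  shows "(\<lambda>l. real_of_int \<lfloor>x * 2 ^ l\<rfloor> / 2 ^ l) \<longlonglongrightarrow> x"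
proof (rule tendsto_sandwich)
  show "eventually (\<lambda>l. x - 1 / 2 ^ l \<le> real_of_int \<lfloor>x * 2 ^ l\<rfloor> / 2 ^ l) sequentially"
  proof (intro always_eventually allI)
    fix l :: nat
    have "x * 2 ^ l - 1 \<le> real_of_int \<lfloor>x * 2 ^ l\<rfloor>" by linarith
    then have "(x * 2 ^ l - 1) / 2 ^ l \<le> real_of_int \<lfloor>x * 2 ^ l\<rfloor> / 2 ^ l"
      by (intro divide_right_mono) auto
    then show "x - 1 / 2 ^ l \<le> real_of_int \<lfloor>x * 2 ^ l\<rfloor> / 2 ^ l"
      by (simp add: diff_divide_distrib)
  qed
  show "eventually (\<lambda>l. real_of_int \<lfloor>x * 2 ^ l\<rfloor> / 2 ^ l \<le> x) sequentially"
    by (intro always_eventually allI) (simp add: field_simps)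
  have "(\<lambda>l. x - (1 / 2) ^ l) \<longlonglongrightarrow> x - 0"
    by (intro tendsto_intros) simp
  then show "(\<lambda>l. x - 1 / 2 ^ l) \<longlonglongrightarrow> x"
    by (simp add: power_one_over)
qed simp

text \<open>Dyadic points are dense in the interval and \<open>f\<close> is continuous. Thus the
  deviation over a whole cell is controlled by countably many conditions, which can be made into an
  event.\<close>

lemma dyadic_oscillation:
  fixes f :: "real \<Rightarrow> real"
  assumes f: "continuous_on {s..s + h} f" and "0 < h"
    and dyadic: "\<And>l i. i \<le> 2 ^ l \<Longrightarrow> \<bar>f (s + real i * h / 2 ^ l) - f s\<bar> \<le> a"
    and t: "t \<in> {s..s + h}"
  shows "\<bar>f t - f s\<bar> \<le> a"
proof -
  define x where "x = (t - s) / h"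
  have x: "0 \<le> x" "x \<le> 1" "t = s + x * h"
    using t \<open>0 < h\<close> by (auto simp: x_def)
  define i where "i l = nat \<lfloor>x * 2 ^ l\<rfloor>" for l :: nat
  have i: "real (i l) = real_of_int \<lfloor>x * 2 ^ l\<rfloor>" for l
    using x by (simp add: i_def)
  have le: "i l \<le> 2 ^ l" for l
  proof -
    have "x * 2 ^ l \<le> 1 * 2 ^ l"
      using x by (intro mult_right_mono) auto
    then have "real (i l) \<le> 2 ^ l"
      unfolding i by (intro order_trans[OF of_int_floor_le]) simp
    then have "real (i l) \<le> real (2 ^ l)" by simp
    then show ?thesis unfolding of_nat_le_iff .
  qed
  have mem: "s + real (i l) * h / 2 ^ l \<in> {s..s + h}" for l
  proof -
    have "real (i l) \<le> real (2 ^ l)"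
      using le[of l] unfolding of_nat_le_iff .
    then have "real (i l) * h \<le> 2 ^ l * h"
      using \<open>0 < h\<close> by (intro mult_right_mono) auto
    then show ?thesis using \<open>0 < h\<close> by (simp add: pos_divide_le_eq mult.commute)
  qed
  have "(\<lambda>l. s + real (i l) / 2 ^ l * h) \<longlonglongrightarrow> s + x * h"
    unfolding i by (intro tendsto_intros dyadic_floor_tendsto)
  then have "(\<lambda>l. f (s + real (i l) * h / 2 ^ l)) \<longlonglongrightarrow> f t"
    using x(3) mem t by (intro continuous_on_tendsto_compose[OF f]) auto
  then have "(\<lambda>l. \<bar>f (s + real (i l) * h / 2 ^ l) - f s\<bar>) \<longlonglongrightarrow> \<bar>f t - f s\<bar>"
    by (intro tendsto_intros)
  then show ?thesis
    by (rule LIMSEQ_le_const2) (use dyadic le in auto)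
qed

text \<open>
  The steps of \<open>w\<close> go against the sign of the current deviation of \<open>w + z\<close> and outweigh the moves
  of \<open>z\<close>, so at grid times the deviation cannot exceed one overshoot \<open>a + r\<close>.
\<close>

lemma tracking_bound:
  fixes w z :: "real \<Rightarrow> real" and h :: real
  assumes w: "\<And>k t. k < n \<Longrightarrow> t \<in> {s + real k * h..s + real k * h + h} \<Longrightarrow> \<bar>w t - w (s + real k * h)\<bar> \<le> a"
    and z: "\<And>k t. k < n \<Longrightarrow> t \<in> {s + real k * h..s + real k * h + h} \<Longrightarrow> \<bar>z t - z (s + real k * h)\<bar> \<le> r"
    and up: "\<And>k. k < n \<Longrightarrow> w (s + real k * h) + z (s + real k * h) < w s + z s \<Longrightarrow>
      r \<le> w (s + real k * h + h) - w (s + real k * h)"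
    and down: "\<And>k. k < n \<Longrightarrow> w s + z s \<le> w (s + real k * h) + z (s + real k * h) \<Longrightarrow>
      w (s + real k * h + h) - w (s + real k * h) \<le> - r"
    and "0 \<le> h" "0 \<le> a" "0 \<le> r" and t: "t \<in> {s..s + real n * h}"
  shows "\<bar>w t + z t - (w s + z s)\<bar> \<le> 2 * (a + r)"
proof -
  have "k \<le> n \<Longrightarrow> \<bar>w (s + real k * h) + z (s + real k * h) - (w s + z s)\<bar> \<le> a + r \<and>
    (\<forall>t\<in>{s..s + real k * h}. \<bar>w t + z t - (w s + z s)\<bar> \<le> 2 * (a + r))" for k
  proof (induction k)
    case 0
    then show ?case using assms by auto
  next
    case (Suc k)
    let ?u = "s + real k * h"
    have k: "k < n" using Suc.prems by simp
    have Suc_eq: "s + real (Suc k) * h = ?u + h"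
      by (simp add: algebra_simps)
    have end_mem: "?u + h \<in> {?u..?u + h}" using \<open>0 \<le> h\<close> by simp
    note steps = w[OF k end_mem] z[OF k end_mem] up[OF k] down[OF k]
    have IH: "\<bar>w ?u + z ?u - (w s + z s)\<bar> \<le> a + r"
      "\<And>t. t \<in> {s..?u} \<Longrightarrow> \<bar>w t + z t - (w s + z s)\<bar> \<le> 2 * (a + r)"
      using Suc by auto
    \<comment> \<open>Below the starting value, \<open>w\<close> rises by at least \<open>r\<close>
      and at most \<open>a\<close>, and \<open>z\<close> moves by at most \<open>r\<close>: the
      deviation cannot decrease, and having been negative it ends at most at \<open>a + r\<close>.
      Otherwise the signs are reversed.\<close>
    have "\<bar>w (?u + h) + z (?u + h) - (w s + z s)\<bar> \<le> a + r"
      using steps IH(1) by (cases "w ?u + z ?u < w s + z s") auto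
    moreover have "\<bar>w t + z t - (w s + z s)\<bar> \<le> 2 * (a + r)" if "t \<in> {s..?u + h}" for t
    proof (cases "t \<le> ?u")
      case False
      then have "t \<in> {?u..?u + h}" using that by simp
      from w[OF k this] z[OF k this] IH(1) show ?thesis by (auto simp: abs_le_iff)
    qed (use IH(2) that in auto)
    ultimately show ?case unfolding Suc_eq by blast
  qed
  from this[of n] t show ?thesis by simp
qed

text \<open>\<open>C\<close> confines the path relative to its value at \<open>s\<close> throughout
  the cell, \<open>D\<close> confines the increment over the cell. For a continuous path and closed
  \<open>C\<close> the dyadic times stand for all times in \<open>[s, s + h]\<close>; using only
  them keeps the event measurable without continuity of every path.\<close>

definition dyadic_event ::
  "'a set \<Rightarrow> (real \<Rightarrow> 'a \<Rightarrow> 'b::real_normed_vector) \<Rightarrow> real \<Rightarrow> real \<Rightarrow> 'b set \<Rightarrow> 'b set \<Rightarrow> 'a set" where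
  "dyadic_event \<Omega> W s h C D = {\<omega>\<in>\<Omega>. W (s + h) \<omega> - W s \<omega> \<in> D \<and>
     (\<forall>l. \<forall>i\<le>2 ^ l. W (s + real i * h / 2 ^ l) \<omega> - W s \<omega> \<in> C)}"

text \<open>\<open>N\<close> is arbitrary because such events have to be placed in \<open>M\<close>,
  in \<open>F\<close> at the end of the cell, and in the \<sigma>-algebras generated by
  \<open>W\<close> and by \<open>Z\<close>.\<close>

lemma dyadic_event_measurable:
  fixes W :: "real \<Rightarrow> 'a \<Rightarrow> 'b::euclidean_space"
  assumes N: "\<And>t. s \<le> t \<Longrightarrow> t \<le> s + h \<Longrightarrow> W t \<in> borel_measurable N"
    and "0 \<le> h" and [measurable]: "C \<in> sets borel" "D \<in> sets borel"
  shows "dyadic_event (space N) W s h C D \<in> sets N"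
proof -
  have [measurable]: "W s \<in> borel_measurable N" "W (s + h) \<in> borel_measurable N"
    using assms by auto
  have *: "W (s + real i * h / 2 ^ l) \<in> borel_measurable N" if "i \<le> 2 ^ l" for i l
  proof (rule N)
    have "real i \<le> real (2 ^ l)"
      using that unfolding of_nat_le_iff .
    then have "real i * h \<le> 2 ^ l * h"
      using \<open>0 \<le> h\<close> by (intro mult_right_mono) auto
    then show "s + real i * h / 2 ^ l \<le> s + h" by (simp add: pos_divide_le_eq mult.commute)
  qed (use \<open>0 \<le> h\<close> in auto)
  have "{\<omega>\<in>space N. \<forall>l. \<forall>i\<in>{..2 ^ l}. W (s + real i * h / 2 ^ l) \<omega> - W s \<omega> \<in> C} \<in> sets N"
  proof (intro sets.sets_Collect_countable_All sets.sets_Collect_finite_All')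
    fix l i :: nat assume "i \<in> {..2 ^ l}"
    then have [measurable]: "W (s + real i * h / 2 ^ l) \<in> borel_measurable N" using * by auto
    show "{\<omega>\<in>space N. W (s + real i * h / 2 ^ l) \<omega> - W s \<omega> \<in> C} \<in> sets N" by measurable
  qed auto
  moreover have "{\<omega>\<in>space N. W (s + h) \<omega> - W s \<omega> \<in> D} \<in> sets N" by measurable
  ultimately have "{\<omega>\<in>space N. W (s + h) \<omega> - W s \<omega> \<in> D} \<inter>
     {\<omega>\<in>space N. \<forall>l. \<forall>i\<in>{..2 ^ l}. W (s + real i * h / 2 ^ l) \<omega> - W s \<omega> \<in> C} \<in> sets N"
    by blast
  also have "{\<omega>\<in>space N. W (s + h) \<omega> - W s \<omega> \<in> D} \<inter>
     {\<omega>\<in>space N. \<forall>l. \<forall>i\<in>{..2 ^ l}. W (s + real i * h / 2 ^ l) \<omega> - W s \<omega> \<in> C} = dyadic_event (space N) W s h C D"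
    by (auto simp: dyadic_event_def)
  finally show ?thesis .
qed

section \<open>Independence of the Brownian future from the past\<close>

locale brownian_model = usual_filtered_prob_space M F
  for M :: "'a measure" and F +
  fixes W :: "real \<Rightarrow> 'a \<Rightarrow> real ^ 'n"
  assumes brownian_W: "brownian_motion M F W"
begin

lemma W_adapted: "0 \<le> t \<Longrightarrow> W t \<in> borel_measurable (F (ennreal t))"
  using brownian_W unfolding brownian_motion_def adapted_def by blast

lemma measurable_F_mono:
  "f \<in> measurable (F s) N \<Longrightarrow> s \<le> t \<Longrightarrow> f \<in> measurable (F t) N"
  using sets_F_mono[of s t] by (auto simp: measurable_def space_F)

lemma measurable_F_imp:
  "f \<in> measurable (F s) N \<Longrightarrow> f \<in> measurable M N"
  using sets_F_subset by (auto simp: measurable_def space_F)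

lemma W_measurable_F: "0 \<le> t \<Longrightarrow> t \<le> u \<Longrightarrow> W t \<in> borel_measurable (F (ennreal u))"
  by (rule measurable_F_mono[OF W_adapted]) (auto intro: ennreal_leI)

lemma W_measurable: "0 \<le> t \<Longrightarrow> W t \<in> borel_measurable M"
  by (rule measurable_F_imp[OF W_adapted])

lemma increment_indep:
  assumes "0 \<le> s" "s < t" "A \<in> sets (F (ennreal s))" "B \<in> sets borel"
  shows "prob (A \<inter> {\<omega>\<in>space M. W t \<omega> - W s \<omega> \<in> B}) =
    prob A * prob {\<omega>\<in>space M. W t \<omega> - W s \<omega> \<in> B}"
proof -
  have "indep_set (sets (F (ennreal s)))
          (sets (vimage_algebra (space M) (\<lambda>\<omega>. W t \<omega> - W s \<omega>) borel))"
    using brownian_W assms unfolding brownian_motion_def by blast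
  moreover have "{\<omega>\<in>space M. W t \<omega> - W s \<omega> \<in> B} \<in>
      sets (vimage_algebra (space M) (\<lambda>\<omega>. W t \<omega> - W s \<omega>) borel)"
    using in_vimage_algebra[OF assms(4), of "\<lambda>\<omega>. W t \<omega> - W s \<omega>" "space M"]
    by (simp add: vimage_def Int_def conj_commute)
  ultimately show ?thesis
    using assms(3) by (intro indep_setD)
qed

text \<open>The two claims are proved together: membership of the event in \<open>F\<close> at time
  \<open>r m\<close> is what makes the next increment independent of it.\<close>

lemma increments_indep:
  fixes r :: "nat \<Rightarrow> real"
  assumes r: "0 \<le> r 0" "strict_mono r" and A: "A \<in> sets (F (ennreal (r 0)))"
    and B: "\<And>i. B i \<in> sets borel"
  shows "A \<inter> {\<omega>\<in>space M. \<forall>i<m. W (r (Suc i)) \<omega> - W (r i) \<omega> \<in> B i} \<in> sets (F (ennreal (r m)))"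
    and "prob (A \<inter> {\<omega>\<in>space M. \<forall>i<m. W (r (Suc i)) \<omega> - W (r i) \<omega> \<in> B i}) =
      prob A * (\<Prod>i<m. prob {\<omega>\<in>space M. W (r (Suc i)) \<omega> - W (r i) \<omega> \<in> B i})"
proof (induction m)
  case 0
  have "A \<subseteq> space M" using A sets_F_subset sets.sets_into_space by blast
  then have "A \<inter> {\<omega>\<in>space M. \<forall>i<0. W (r (Suc i)) \<omega> - W (r i) \<omega> \<in> B i} = A" by auto
  with A show "A \<inter> {\<omega>\<in>space M. \<forall>i<0. W (r (Suc i)) \<omega> - W (r i) \<omega> \<in> B i} \<in> sets (F (ennreal (r 0)))"
    "prob (A \<inter> {\<omega>\<in>space M. \<forall>i<0. W (r (Suc i)) \<omega> - W (r i) \<omega> \<in> B i}) =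
      prob A * (\<Prod>i<0. prob {\<omega>\<in>space M. W (r (Suc i)) \<omega> - W (r i) \<omega> \<in> B i})"
    by simp_all
next
  case (Suc m)
  let ?A = "\<lambda>m. A \<inter> {\<omega>\<in>space M. \<forall>i<m. W (r (Suc i)) \<omega> - W (r i) \<omega> \<in> B i}"
  let ?D = "{\<omega>\<in>space M. W (r (Suc m)) \<omega> - W (r m) \<omega> \<in> B m}"
  have rm: "0 \<le> r m" "r m < r (Suc m)"
    using r strict_mono_mono[OF r(2)] by (auto simp: strict_mono_def dest: monoD[of r 0 m])
  have eq: "?A (Suc m) = ?A m \<inter> ?D"
    by (auto simp: less_Suc_eq)
  have [measurable]: "W (r (Suc m)) \<in> borel_measurable (F (ennreal (r (Suc m))))"
    "W (r m) \<in> borel_measurable (F (ennreal (r (Suc m))))"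
    using rm by (auto intro!: W_measurable_F)
  have "{\<omega>\<in>space (F (ennreal (r (Suc m)))). W (r (Suc m)) \<omega> - W (r m) \<omega> \<in> B m} \<in> sets (F (ennreal (r (Suc m))))"
    using B by measurable
  then have "?D \<in> sets (F (ennreal (r (Suc m))))" by (simp add: space_F)
  moreover have "?A m \<in> sets (F (ennreal (r (Suc m))))"
    using Suc(1) sets_F_mono[of "ennreal (r m)" "ennreal (r (Suc m))"] rm by (auto intro: ennreal_leI)
  ultimately show "?A (Suc m) \<in> sets (F (ennreal (r (Suc m))))"
    unfolding eq by (rule sets.Int[rotated])
  have "prob (?A (Suc m)) = prob (?A m) * prob ?D"
    unfolding eq using rm Suc(1) B by (rule increment_indep)
  then show "prob (?A (Suc m)) =
      prob A * (\<Prod>i<Suc m. prob {\<omega>\<in>space M. W (r (Suc i)) \<omega> - W (r i) \<omega> \<in> B i})"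
    using Suc(2) by simp
qed

text \<open>Displacements from \<open>W (r 0)\<close> are sums of successive increments. Events
  prescribing the increments one by one form an intersection-stable family, so independence extends
  from the product formula to the generated \<sigma>-algebra, which contains the event about the
  displacements.\<close>

lemma finite_grid_indep:
  fixes r :: "nat \<Rightarrow> real"
  assumes r: "0 \<le> r 0" "strict_mono r" and A: "A \<in> sets (F (ennreal (r 0)))"
    and C: "\<And>i. C i \<in> sets borel"
  shows "prob (A \<inter> {\<omega>\<in>space M. \<forall>i\<le>m. W (r i) \<omega> - W (r 0) \<omega> \<in> C i}) =
      prob A * prob {\<omega>\<in>space M. \<forall>i\<le>m. W (r i) \<omega> - W (r 0) \<omega> \<in> C i}"
proof -
  define P where "P = {{\<omega>\<in>space M. \<forall>i<m. W (r (Suc i)) \<omega> - W (r i) \<omega> \<in> B i} |B.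
    \<forall>i. B i \<in> sets borel}"
  have P_sub: "P \<subseteq> Pow (space M)" by (auto simp: P_def)
  have r_nn: "0 \<le> r i" for i
    using r strict_mono_mono[OF r(2)] by (auto dest: monoD[of r 0 i])
  have P_events: "P \<subseteq> events"
  proof
    fix D assume "D \<in> P"
    then obtain B where B: "D = {\<omega>\<in>space M. \<forall>i<m. W (r (Suc i)) \<omega> - W (r i) \<omega> \<in> B i}" "\<And>i. B i \<in> sets borel"
      by (auto simp: P_def)
    have [measurable]: "W (r i) \<in> borel_measurable M" for i by (rule W_measurable[OF r_nn])
    show "D \<in> events" unfolding B(1) using B(2) by measurable
  qed
  have "indep_set (sets (F (ennreal (r 0)))) P"
    unfolding indep_sets2_eq
  proof (intro conjI ballI P_events sets_F_subset)
    fix A D assume A: "A \<in> sets (F (ennreal (r 0)))" and "D \<in> P"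
    then obtain B where B: "D = {\<omega>\<in>space M. \<forall>i<m. W (r (Suc i)) \<omega> - W (r i) \<omega> \<in> B i}" "\<And>i. B i \<in> sets borel"
      by (auto simp: P_def)
    have sp: "space M \<in> sets (F (ennreal (r 0)))"
      using sets.top[of "F (ennreal (r 0))"] by (simp add: space_F)
    \<comment> \<open>The product formula with the whole space in place of \<open>A\<close>
      evaluates \<open>prob D\<close> itself.\<close>
    have "prob D = (\<Prod>i<m. prob {\<omega>\<in>space M. W (r (Suc i)) \<omega> - W (r i) \<omega> \<in> B i})"
      using increments_indep(2)[where m=m, OF r sp B(2)] unfolding B(1)
      by (simp add: prob_space Int_absorb1 Collect_restrict)
    then show "prob (A \<inter> D) = prob A * prob D"
      using increments_indep(2)[where m=m, OF r A B(2)] B(1) by simp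
  qed
  moreover have "Int_stable P"
  proof (rule Int_stableI)
    fix D E assume "D \<in> P" "E \<in> P"
    then obtain B B' where B: "D = {\<omega>\<in>space M. \<forall>i<m. W (r (Suc i)) \<omega> - W (r i) \<omega> \<in> B i}" "\<And>i. B i \<in> sets borel"
      "E = {\<omega>\<in>space M. \<forall>i<m. W (r (Suc i)) \<omega> - W (r i) \<omega> \<in> B' i}" "\<And>i. B' i \<in> sets borel"
      by (auto simp: P_def)
    then show "D \<inter> E \<in> P"
      unfolding P_def by (intro CollectI exI[of _ "\<lambda>i. B i \<inter> B' i"]) auto
  qed
  moreover have "Int_stable (sets (F (ennreal (r 0))))"
    by (rule sets.Int_stable)
  ultimately have ind: "indep_set (sigma_sets (space M) (sets (F (ennreal (r 0))))) (sigma_sets (space M) P)"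
    by (intro indep_set_sigma_sets)
  define N where "N = sigma (space M) P"
  have space_N: "space N = space M" and sets_N: "sets N = sigma_sets (space M) P"
    using P_sub by (simp_all add: N_def)
  have inc: "(\<lambda>\<omega>. W (r (Suc i)) \<omega> - W (r i) \<omega>) \<in> borel_measurable N" if "i < m" for i
  proof (rule measurableI)
    fix B :: "(real^'n) set" assume B: "B \<in> sets borel"
    have "(\<lambda>\<omega>. W (r (Suc i)) \<omega> - W (r i) \<omega>) -` B \<inter> space N =
        {\<omega>\<in>space M. \<forall>j<m. W (r (Suc j)) \<omega> - W (r j) \<omega> \<in> (if j = i then B else UNIV)}"
      using that by (auto simp: space_N)
    also have "\<dots> \<in> P"
      unfolding P_def using B by (intro CollectI exI[of _ "\<lambda>j. if j = i then B else UNIV"]) auto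
    finally show "(\<lambda>\<omega>. W (r (Suc i)) \<omega> - W (r i) \<omega>) -` B \<inter> space N \<in> sets N"
      unfolding sets_N by auto
  qed auto
  have [measurable]: "(\<lambda>\<omega>. W (r i) \<omega> - W (r 0) \<omega>) \<in> borel_measurable N" if "i \<le> m" for i
  proof -
    have "(\<lambda>\<omega>. \<Sum>l<i. W (r (Suc l)) \<omega> - W (r l) \<omega>) \<in> borel_measurable N"
      using that by (intro borel_measurable_sum inc) auto
    also have "(\<lambda>\<omega>. \<Sum>l<i. W (r (Suc l)) \<omega> - W (r l) \<omega>) = (\<lambda>\<omega>. W (r i) \<omega> - W (r 0) \<omega>)"
      by (rule ext) (rule sum_lessThan_telescope)
    finally show ?thesis .
  qed
  have "{\<omega>\<in>space N. \<forall>i\<in>{..m}. W (r i) \<omega> - W (r 0) \<omega> \<in> C i} \<in> sets N"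
  proof (intro sets.sets_Collect_finite_All')
    fix i assume "i \<in> {..m}"
    then have [measurable]: "(\<lambda>\<omega>. W (r i) \<omega> - W (r 0) \<omega>) \<in> borel_measurable N" by auto
    show "{\<omega>\<in>space N. W (r i) \<omega> - W (r 0) \<omega> \<in> C i} \<in> sets N" using C by measurable
  qed auto
  then have "{\<omega>\<in>space M. \<forall>i\<le>m. W (r i) \<omega> - W (r 0) \<omega> \<in> C i} \<in> sigma_sets (space M) P"
    by (simp add: space_N sets_N Ball_def)
  then show ?thesis
    using A by (intro indep_setD[OF ind]) auto
qed

text \<open>The dyadic event is the decreasing intersection of events on the finite grids of level
  \<open>l\<close>. Each is independent of \<open>A\<close>, and both sides of the product formula
  are continuous along the decreasing sequence.\<close>

lemma dyadic_event_indep: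
  assumes "0 \<le> s" "0 < h" and A: "A \<in> sets (F (ennreal s))"
    and C: "C \<in> sets borel" and D: "D \<in> sets borel"
  shows "prob (A \<inter> dyadic_event (space M) W s h C D) = prob A * prob (dyadic_event (space M) W s h C D)"
proof -
  \<comment> \<open>The index \<open>2 ^ l\<close> is the right end of the cell, where the condition
    \<open>D\<close> is imposed as well.\<close>
  define E where "E l = {\<omega>\<in>space M. \<forall>i\<le>2 ^ l. W (s + real i * h / 2 ^ l) \<omega> - W s \<omega> \<in>
    (if i = 2 ^ l then C \<inter> D else C)}" for l :: nat
  have E_events: "E l \<in> events" for l
  proof -
    have [measurable]: "W s \<in> borel_measurable M" "W (s + real i * h / 2 ^ l) \<in> borel_measurable M" for i
      using assms by (auto intro!: W_measurable)
    have [measurable]: "(if i = 2 ^ l then C \<inter> D else C) \<in> sets borel" for i using C D by auto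
    show ?thesis unfolding E_def by measurable
  qed
  have A_events: "A \<in> events" using A sets_F_subset by blast
  have E_dyadic: "(\<Inter>l. E l) = dyadic_event (space M) W s h C D"
  proof (intro set_eqI iffI)
    fix \<omega> assume E: "\<omega> \<in> (\<Inter>l. E l)"
    then have E: "\<omega> \<in> E l" for l by blast
    have "W (s + real i * h / 2 ^ l) \<omega> - W s \<omega> \<in> C" if "i \<le> 2 ^ l" for i l
      using E[of l] that unfolding E_def by (cases "i = 2 ^ l") auto
    moreover have "W (s + h) \<omega> - W s \<omega> \<in> D"
      using E[of 0] unfolding E_def mem_Collect_eq by (elim conjE allE[of _ 1]) simp
    ultimately show "\<omega> \<in> dyadic_event (space M) W s h C D"
      using E[of 0] by (auto simp: dyadic_event_def E_def)
  next
    fix \<omega> assume \<omega>: "\<omega> \<in> dyadic_event (space M) W s h C D"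
    then have "W (s + h) \<omega> - W s \<omega> \<in> C"
      unfolding dyadic_event_def mem_Collect_eq by (elim conjE allE[of _ 0] allE[of _ 1]) simp
    with \<omega> show "\<omega> \<in> (\<Inter>l. E l)"
      by (auto simp: dyadic_event_def E_def)
  qed
  have dec: "decseq E"
  proof (rule decseq_SucI, rule subsetI)
    fix l \<omega> assume \<omega>: "\<omega> \<in> E (Suc l)"
    have "W (s + real i * h / 2 ^ l) \<omega> - W s \<omega> \<in> (if i = 2 ^ l then C \<inter> D else C)" if "i \<le> 2 ^ l" for i
    proof -
      \<comment> \<open>The point \<open>i\<close> of level \<open>l\<close> is the point
        \<open>2 * i\<close> of level \<open>Suc l\<close>, so finer grids impose more
        conditions.\<close>
      have "W (s + real (2 * i) * h / 2 ^ Suc l) \<omega> - W s \<omega> \<in> (if 2 * i = 2 ^ Suc l then C \<inter> D else C)"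
        using \<omega> that unfolding E_def mem_Collect_eq by (elim conjE allE[of _ "2 * i"]) simp
      then show ?thesis by simp
    qed
    moreover have "\<omega> \<in> space M" using \<omega> by (simp add: E_def)
    ultimately show "\<omega> \<in> E l" by (simp add: E_def)
  qed
  have ind: "prob (A \<inter> E l) = prob A * prob (E l)" for l
  proof -
    define r where "r i = s + real i * h / 2 ^ l" for i :: nat
    have "strict_mono r"
      using \<open>0 < h\<close> by (auto simp: strict_mono_def r_def divide_strict_right_mono)
    moreover have "r 0 = s" by (simp add: r_def)
    ultimately show ?thesis
      using finite_grid_indep[of r A "\<lambda>i. if i = 2 ^ l then C \<inter> D else C" "2 ^ l"] assms
      unfolding E_def by (simp add: r_def)
  qed
  have "(\<lambda>l. prob (E l)) \<longlonglongrightarrow> prob (\<Inter>l. E l)"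
    using E_events dec by (intro finite_Lim_measure_decseq) auto
  then have "(\<lambda>l. prob A * prob (E l)) \<longlonglongrightarrow> prob A * prob (\<Inter>l. E l)"
    by (intro tendsto_intros)
  moreover have "(\<lambda>l. prob (A \<inter> E l)) \<longlonglongrightarrow> prob (\<Inter>l. A \<inter> E l)"
    using E_events A_events dec by (intro finite_Lim_measure_decseq) (auto simp: decseq_def)
  ultimately have "prob (\<Inter>l. A \<inter> E l) = prob A * prob (\<Inter>l. E l)"
    unfolding ind by (rule LIMSEQ_unique[rotated])
  then show ?thesis
    unfolding E_dyadic[symmetric] by simp
qed

end

section \<open>Stickiness\<close>

lemma measurable_vec_nth:
  fixes f :: "'a \<Rightarrow> real ^ 'n"
  assumes "f \<in> borel_measurable N"
  shows "(\<lambda>\<omega>. f \<omega> $ \<nu>) \<in> borel_measurable N"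
  by (rule measurable_compose[OF assms borel_measurable_continuous_onI]) (intro continuous_intros)

definition cube :: "real \<Rightarrow> (real ^ 'n) set" where
  "cube r = {y. \<forall>\<nu>. \<bar>y $ \<nu>\<bar> \<le> r}"

lemma cube_borel [measurable]: "cube r \<in> sets borel"
proof -
  have "cube r = (cbox (\<chi> \<nu>. - r) (\<chi> \<nu>. r) :: (real ^ 'n) set)"
    by (auto simp: cube_def mem_box_cart abs_le_iff minus_le_iff)
  then show ?thesis by (metis borel_closed closed_cbox)
qed

lemma cubeI: "norm y \<le> r \<Longrightarrow> y \<in> cube r"
  unfolding cube_def using component_le_norm_cart order_trans by blast

text \<open>Here \<open>Z\<close> has as many components as \<open>W\<close>. It is instantiated
  with the image of the given perturbation under a right inverse of \<open>\<sigma>\<close>, so that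
  \<open>W\<close> can offset it coordinate by coordinate.\<close>

locale perturbed_brownian = brownian_model M F W
  for M :: "'a measure" and F and W :: "real \<Rightarrow> 'a \<Rightarrow> real ^ 'n" +
  fixes Z :: "real \<Rightarrow> 'a \<Rightarrow> real ^ 'n" and \<alpha> :: real
  assumes adapted_Z: "adapted F Z"
    and independent_Z_W: "independent_processes M Z W"
    and \<alpha>: "1 / 2 < \<alpha>"
    and holder_Z: "holder_on_compacts M \<alpha> Z"
begin

lemma Z_adapted: "0 \<le> t \<Longrightarrow> Z t \<in> borel_measurable (F (ennreal t))"
  using adapted_Z unfolding adapted_def by blast

lemma Z_measurable_F: "0 \<le> t \<Longrightarrow> t \<le> u \<Longrightarrow> Z t \<in> borel_measurable (F (ennreal u))"
  by (rule measurable_F_mono[OF Z_adapted]) (auto intro: ennreal_leI)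

lemma Z_measurable: "0 \<le> t \<Longrightarrow> Z t \<in> borel_measurable M"
  by (rule measurable_F_imp[OF Z_adapted])

section \<open>Almost sure regularity of the paths of \<open>W\<close> and \<open>Z\<close>\<close>

lemma AE_continuous_W: "AE \<omega> in M. continuous_on {0..} (\<lambda>t. W t \<omega>)"
  using brownian_W unfolding brownian_motion_def by blast

lemma AE_Z_holder:
  "AE \<omega> in M. \<forall>K::nat. \<exists>C>0. \<forall>s t. 0 \<le> s \<longrightarrow> s \<le> t \<longrightarrow> t \<le> real K \<longrightarrow>
     norm (Z t \<omega> - Z s \<omega>) \<le> C * \<bar>t - s\<bar> powr \<alpha>"
  unfolding AE_all_countable
proof
  fix K :: nat
  obtain C where C: "\<forall>\<omega>\<in>space M. 0 < C \<omega>"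
    "AE \<omega> in M. \<forall>s t. 0 \<le> s \<and> s \<le> t \<and> t \<le> real K \<longrightarrow> norm (Z t \<omega> - Z s \<omega>) \<le> C \<omega> * \<bar>t - s\<bar> powr \<alpha>"
    using holder_Z unfolding holder_on_compacts_def by blast
  from C(2) AE_space show "AE \<omega> in M. \<exists>C>0. \<forall>s t. 0 \<le> s \<longrightarrow> s \<le> t \<longrightarrow> t \<le> real K \<longrightarrow>
     norm (Z t \<omega> - Z s \<omega>) \<le> C * \<bar>t - s\<bar> powr \<alpha>"
  proof eventually_elim
    case (elim \<omega>)
    then show ?case using C(1) by (intro exI[of _ "C \<omega>"]) auto
  qed
qed

lemma AE_continuous_Z: "AE \<omega> in M. continuous_on {0..} (\<lambda>t. Z t \<omega>)"
  using AE_Z_holder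
proof eventually_elim
  case (elim \<omega>)
  show ?case
    unfolding continuous_on_def
  proof
    fix t :: real assume t: "t \<in> {0..}"
    obtain K :: nat where K: "t + 1 < real K" using reals_Archimedean2 by blast
    from elim obtain C where C: "0 < C" "\<And>s t. 0 \<le> s \<Longrightarrow> s \<le> t \<Longrightarrow> t \<le> real K \<Longrightarrow>
        norm (Z t \<omega> - Z s \<omega>) \<le> C * \<bar>t - s\<bar> powr \<alpha>" by metis
    have "((\<lambda>x. Z x \<omega> - Z t \<omega>) \<longlongrightarrow> 0) (at t within {0..})"
    proof (rule Lim_null_comparison)
      have "eventually (\<lambda>x. x < t + 1) (at t within {0..})"
        by (intro order_tendstoD(2)[OF tendsto_ident_at]) simp
      moreover have "eventually (\<lambda>x. x \<in> {0..}) (at t within {0..})"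
        by (simp add: eventually_at_filter)
      ultimately show "eventually (\<lambda>x. norm (Z x \<omega> - Z t \<omega>) \<le> C * \<bar>x - t\<bar> powr \<alpha>) (at t within {0..})"
      proof eventually_elim
        case (elim x)
        show ?case
        proof (cases "t \<le> x")
          case True
          then show ?thesis using C(2)[of t x] elim K t by auto
        next
          case False
          then show ?thesis using C(2)[of x t] elim K t by (auto simp: norm_minus_commute abs_minus_commute)
        qed
      qed
      have "((\<lambda>x. \<bar>x - t\<bar> powr \<alpha>) \<longlongrightarrow> 0) (at t within {0..})"
      proof (rule tendsto_zero_powrI)
        have "((\<lambda>x. \<bar>x - t\<bar>) \<longlongrightarrow> \<bar>t - t\<bar>) (at t within {0..})"
          by (intro tendsto_intros)
        then show "((\<lambda>x. \<bar>x - t\<bar>) \<longlongrightarrow> 0) (at t within {0..})" by simp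
      qed (use \<alpha> in auto)
      then show "((\<lambda>x. C * \<bar>x - t\<bar> powr \<alpha>) \<longlongrightarrow> 0) (at t within {0..})"
        by (rule tendsto_mult_right_zero)
    qed
    then show "((\<lambda>t. Z t \<omega>) \<longlongrightarrow> Z t \<omega>) (at t within {0..})"
      by (simp add: Lim_null[symmetric])
  qed
qed

text \<open>Here \<open>\<alpha> > 1 / 2\<close> enters: \<open>C * h powr \<alpha>\<close> is
  \<open>sqrt h\<close> times \<open>C * h powr (\<alpha> - 1 / 2)\<close>, and the latter tends to
  0. Moves of \<open>Z\<close> are thus of smaller order than typical Brownian moves.\<close>

lemma AE_Z_small:
  "AE \<omega> in M. \<forall>U. \<forall>\<epsilon>>0. \<forall>\<^sub>F h in at_right 0. \<forall>s t. 0 \<le> s \<longrightarrow> s \<le> t \<longrightarrow> t \<le> U \<longrightarrow> t - s \<le> h \<longrightarrow>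
     norm (Z t \<omega> - Z s \<omega>) \<le> \<epsilon> * sqrt h"
  using AE_Z_holder
proof eventually_elim
  case (elim \<omega>)
  show ?case
  proof (intro allI impI)
    fix U \<epsilon> :: real assume "0 < \<epsilon>"
    obtain K :: nat where K: "U < real K" using reals_Archimedean2 by blast
    from elim obtain C where C: "0 < C" "\<And>s t. 0 \<le> s \<Longrightarrow> s \<le> t \<Longrightarrow> t \<le> real K \<Longrightarrow>
        norm (Z t \<omega> - Z s \<omega>) \<le> C * \<bar>t - s\<bar> powr \<alpha>" by metis
    have "((\<lambda>h. h powr (\<alpha> - 1 / 2)) \<longlongrightarrow> 0) (at_right (0::real))"
      using \<alpha> by (intro tendsto_zero_powrI tendsto_ident_at tendsto_const)
        (auto simp: eventually_at_filter)
    then have "((\<lambda>h. C * h powr (\<alpha> - 1 / 2)) \<longlongrightarrow> 0) (at_right (0::real))"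
      by (rule tendsto_mult_right_zero)
    then have "\<forall>\<^sub>F h in at_right 0. C * h powr (\<alpha> - 1 / 2) < \<epsilon>"
      using \<open>0 < \<epsilon>\<close> by (rule order_tendstoD)
    moreover have "\<forall>\<^sub>F h in at_right (0::real). 0 < h"
      by (simp add: eventually_at_filter)
    ultimately show "\<forall>\<^sub>F h in at_right 0. \<forall>s t. 0 \<le> s \<longrightarrow> s \<le> t \<longrightarrow> t \<le> U \<longrightarrow> t - s \<le> h \<longrightarrow>
     norm (Z t \<omega> - Z s \<omega>) \<le> \<epsilon> * sqrt h"
    proof eventually_elim
      case (elim h)
      show ?case
      proof (intro allI impI)
        fix s t :: real assume st: "0 \<le> s" "s \<le> t" "t \<le> U" "t - s \<le> h"
        have "norm (Z t \<omega> - Z s \<omega>) \<le> C * \<bar>t - s\<bar> powr \<alpha>"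
          using st K by (intro C(2)) auto
        also have "\<dots> \<le> C * h powr \<alpha>"
          using st C(1) \<alpha> by (intro mult_left_mono powr_mono2) auto
        also have "\<dots> = C * h powr (\<alpha> - 1 / 2) * sqrt h"
          using elim by (simp add: powr_half_sqrt[symmetric] powr_add[symmetric])
        also have "\<dots> \<le> \<epsilon> * sqrt h"
          using elim by (intro mult_right_mono) auto
        finally show "norm (Z t \<omega> - Z s \<omega>) \<le> \<epsilon> * sqrt h" .
      qed
    qed
  qed
qed

lemma AE_W_small:
  "AE \<omega> in M. \<forall>U. \<forall>a>0. \<forall>\<^sub>F h in at_right 0. \<forall>s t. 0 \<le> s \<longrightarrow> s \<le> t \<longrightarrow> t \<le> U \<longrightarrow> t - s \<le> h \<longrightarrow>
     norm (W t \<omega> - W s \<omega>) \<le> a"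
  using AE_continuous_W
proof eventually_elim
  case (elim \<omega>)
  show ?case
  proof (intro allI impI)
    fix U a :: real assume "0 < a"
    have "uniformly_continuous_on {0..U} (\<lambda>t. W t \<omega>)"
      using elim by (intro compact_uniformly_continuous) (auto intro: continuous_on_subset)
    then obtain d where d: "0 < d" "\<And>s t. s \<in> {0..U} \<Longrightarrow> t \<in> {0..U} \<Longrightarrow> dist t s < d \<Longrightarrow> dist (W t \<omega>) (W s \<omega>) < a"
      using \<open>0 < a\<close> unfolding uniformly_continuous_on_def by metis
    have "\<forall>\<^sub>F h in at_right 0. h < d"
      using d(1) by (intro order_tendstoD(2)[OF tendsto_ident_at])
    then show "\<forall>\<^sub>F h in at_right 0. \<forall>s t. 0 \<le> s \<longrightarrow> s \<le> t \<longrightarrow> t \<le> U \<longrightarrow> t - s \<le> h \<longrightarrow>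
     norm (W t \<omega> - W s \<omega>) \<le> a"
    proof eventually_elim
      case (elim h)
      show ?case
      proof (intro allI impI)
        fix s t assume "0 \<le> s" "s \<le> t" "t \<le> U" "t - s \<le> h"
        then have "dist (W t \<omega>) (W s \<omega>) < a"
          using elim by (intro d(2)) (auto simp: dist_real_def)
        then show "norm (W t \<omega> - W s \<omega>) \<le> a" by (simp add: dist_norm)
      qed
    qed
  qed
qed

text \<open>On almost every path one modulus of continuity on \<open>[0, U]\<close> serves all cells
  at once, however many there are. The path is therefore outside the bad event for all large
  \<open>j\<close>, and no sum over cells arises.\<close>

lemma prob_bad_grid_tendsto_0:
  fixes Y :: "real \<Rightarrow> 'a \<Rightarrow> real ^ 'n" and r :: "real \<Rightarrow> real"
  assumes Y: "\<And>t. 0 \<le> t \<Longrightarrow> Y t \<in> borel_measurable M"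
    and small: "AE \<omega> in M. \<forall>U. \<forall>\<^sub>F h in at_right 0. \<forall>s t. 0 \<le> s \<longrightarrow> s \<le> t \<longrightarrow> t \<le> U \<longrightarrow> t - s \<le> h \<longrightarrow>
      norm (Y t \<omega> - Y s \<omega>) \<le> r h"
    and h: "filterlim h (at_right 0) sequentially" "\<And>j. 0 < h j"
    and "0 \<le> s" and N: "\<And>j. s + real (N j) * h j \<le> U"
  shows "(\<lambda>j. prob (space M - (\<Inter>k\<in>{..<N j}. dyadic_event (space M) Y (s + real k * h j) (h j) (cube (r (h j))) UNIV)))
    \<longlonglongrightarrow> 0"
proof (rule prob_tendsto_0_if_eventually_notin)
  fix j
  have "dyadic_event (space M) Y (s + real k * h j) (h j) (cube (r (h j))) UNIV \<in> events" for k
  proof (intro dyadic_event_measurable Y)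
    fix t assume "s + real k * h j \<le> t"
    moreover have "0 \<le> real k * h j" using h(2)[of j] by simp
    ultimately show "0 \<le> t" using \<open>0 \<le> s\<close> by simp
  qed (use h(2)[of j] in auto)
  then show "space M - (\<Inter>k\<in>{..<N j}. dyadic_event (space M) Y (s + real k * h j) (h j) (cube (r (h j))) UNIV) \<in> events"
    by (cases "N j = 0") (auto intro!: sets.Diff sets.finite_INT)
next
  from small AE_space
  show "AE \<omega> in M. \<forall>\<^sub>F j in sequentially. \<omega> \<notin> space M -
    (\<Inter>k\<in>{..<N j}. dyadic_event (space M) Y (s + real k * h j) (h j) (cube (r (h j))) UNIV)"
  proof eventually_elim
    case (elim \<omega>)
    have "\<forall>\<^sub>F j in sequentially. \<forall>s t. 0 \<le> s \<longrightarrow> s \<le> t \<longrightarrow> t \<le> U \<longrightarrow> t - s \<le> h j \<longrightarrow>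
        norm (Y t \<omega> - Y s \<omega>) \<le> r (h j)"
      using elim(1) h(1) by (auto simp: filterlim_iff)
    then show ?case
    proof eventually_elim
      case (elim j)
      have "\<omega> \<in> dyadic_event (space M) Y (s + real k * h j) (h j) (cube (r (h j))) UNIV" if "k < N j" for k
        unfolding dyadic_event_def
      proof (intro CollectI conjI allI impI \<open>\<omega> \<in> space M\<close> UNIV_I cubeI)
        fix l i :: nat assume "i \<le> 2 ^ l"
        then have "real i \<le> real (2 ^ l)" unfolding of_nat_le_iff .
        then have "real i * h j \<le> 2 ^ l * h j"
          using h(2)[of j] by (intro mult_right_mono) auto
        then have ih: "0 \<le> real i * h j / 2 ^ l" "real i * h j / 2 ^ l \<le> h j"
          using h(2)[of j] by (simp_all add: pos_divide_le_eq mult.commute)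
        have "real (Suc k) * h j \<le> real (N j) * h j"
          using \<open>k < N j\<close> h(2)[of j] by (intro mult_right_mono) auto
        then have "s + real k * h j + h j \<le> U"
          using N[of j] by (simp add: algebra_simps)
        moreover have "0 \<le> real k * h j" using h(2)[of j] by simp
        ultimately show "norm (Y (s + real k * h j + real i * h j / 2 ^ l) \<omega> - Y (s + real k * h j) \<omega>) \<le> r (h j)"
          using elim ih \<open>0 \<le> s\<close> by simp
      qed
      then show ?case by auto
    qed
  qed
qed


section \<open>Steering relative to the whole of \<open>Z\<close>, and stickiness of
  \<open>W + Z\<close>\<close>

text \<open>
  The second filtration for which the steering density is a martingale: it knows all of \<open>Z\<close> from
  the start.
\<close>

definition joint_history :: "real \<Rightarrow> 'a measure" where
  "joint_history t = sigma (space M) {D \<inter> C |D C. D \<in> sets (generated_by (space M) Z) \<and>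
     C \<in> sets (F (ennreal t)) \<inter> sets (generated_by (space M) W)}"

lemma generated_sets_events:
  "sets (generated_by (space M) Z) \<subseteq> events" "sets (generated_by (space M) W) \<subseteq> events"
  using independent_Z_W unfolding independent_processes_def
  by (blast dest: indep_setD_ev1 indep_setD_ev2)+

lemma space_joint_history [simp]: "space (joint_history t) = space M"
  by (simp add: joint_history_def space_measure_of_conv)

lemma sets_joint_history:
  "sets (joint_history t) = sigma_sets (space M) {D \<inter> C |D C. D \<in> sets (generated_by (space M) Z) \<and>
     C \<in> sets (F (ennreal t)) \<inter> sets (generated_by (space M) W)}"
  unfolding joint_history_def using generated_sets_events sets.sets_into_space
  by (intro sets_measure_of) blast

lemma joint_history_events: "sets (joint_history t) \<subseteq> events"
  unfolding sets_joint_history using generated_sets_events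
  by (intro sets.sigma_sets_subset) auto

lemma joint_history_mono:
  assumes "t \<le> u" shows "sets (joint_history t) \<subseteq> sets (joint_history u)"
  unfolding sets_joint_history using sets_F_mono[OF ennreal_leI[OF assms]]
  by (intro sigma_sets_mono') auto

lemma generated_Z_joint: "sets (generated_by (space M) Z) \<subseteq> sets (joint_history t)"
proof
  fix D assume D: "D \<in> sets (generated_by (space M) Z)"
  then have "D = D \<inter> space M" using generated_sets_events sets.sets_into_space by blast
  moreover have "space M \<in> sets (F (ennreal t))" "space M \<in> sets (generated_by (space M) W)"
    using sets.top[of "F (ennreal t)"] sets.top[of "generated_by (space M) W"] by (simp_all add: space_F)
  ultimately show "D \<in> sets (joint_history t)"
    unfolding sets_joint_history using D by (intro sigma_sets.Basic) blast
qed

lemma F_generated_W_joint: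
  assumes C: "C \<in> sets (F (ennreal t))" "C \<in> sets (generated_by (space M) W)"
  shows "C \<in> sets (joint_history t)"
proof -
  have "C = space M \<inter> C" using C generated_sets_events sets.sets_into_space by blast
  moreover have "space M \<in> sets (generated_by (space M) Z)"
    using sets.top[of "generated_by (space M) Z"] by simp
  ultimately show ?thesis
    unfolding sets_joint_history using C by (intro sigma_sets.Basic) blast
qed

lemma Z_measurable_joint: "0 \<le> t \<Longrightarrow> Z t \<in> borel_measurable (joint_history u)"
  using measurable_generated_by[of t Z "space M"] generated_Z_joint[of u]
  by (auto simp: measurable_def)

lemma W_measurable_joint:
  assumes "0 \<le> t" "t \<le> u" shows "W t \<in> borel_measurable (joint_history u)"
  using measurable_generated_by[of t W "space M"] W_measurable_F[OF assms] assms(1)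
  by (auto simp: measurable_def space_F intro: F_generated_W_joint)

text \<open>On a generator \<open>D \<inter> C\<close>, independence of \<open>Z\<close> from
  \<open>W\<close> splits off \<open>D\<close>, since \<open>C\<close> and \<open>E\<close> both
  come from \<open>W\<close>; then \<open>E\<close> splits from \<open>C\<close>, since
  \<open>C\<close> is also in \<open>F\<close> at time \<open>t\<close>. This is the reason for the
  double condition on \<open>C\<close> in \<open>joint_history\<close>.\<close>

lemma joint_history_indep:
  assumes E: "E \<in> sets (generated_by (space M) W)"
    and F_indep: "\<And>C. C \<in> sets (F (ennreal t)) \<Longrightarrow> prob (C \<inter> E) = prob C * prob E"
    and B: "B \<in> sets (joint_history t)"
  shows "prob (B \<inter> E) = prob B * prob E"
proof -
  let ?P = "{D \<inter> C |D C. D \<in> sets (generated_by (space M) Z) \<and>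
     C \<in> sets (F (ennreal t)) \<inter> sets (generated_by (space M) W)}"
  have ZW: "prob (D \<inter> C) = prob D * prob C"
    if "D \<in> sets (generated_by (space M) Z)" "C \<in> sets (generated_by (space M) W)" for C D
    using independent_Z_W that unfolding independent_processes_def by (intro indep_setD)
  have "indep_set ?P {E}"
    unfolding indep_sets2_eq
  proof (intro conjI ballI)
    show "?P \<subseteq> events" "{E} \<subseteq> events" using generated_sets_events E by auto
    fix B E' assume "B \<in> ?P" and "E' \<in> {E}"
    then have [simp]: "E' = E" by simp
    from \<open>B \<in> ?P\<close> obtain D C where B: "B = D \<inter> C" "D \<in> sets (generated_by (space M) Z)"
      "C \<in> sets (F (ennreal t))" "C \<in> sets (generated_by (space M) W)" by blast
    have "prob (D \<inter> (C \<inter> E)) = prob D * prob (C \<inter> E)"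
      using B E by (intro ZW) auto
    then show "prob (B \<inter> E') = prob B * prob E'"
      using B ZW[of D C] F_indep[of C] by (simp add: Int_assoc)
  qed
  moreover have "Int_stable ?P"
  proof (rule Int_stableI)
    fix B B' assume "B \<in> ?P" "B' \<in> ?P"
    then obtain D C D' C' where "B = D \<inter> C" "D \<in> sets (generated_by (space M) Z)"
      "C \<in> sets (F (ennreal t)) \<inter> sets (generated_by (space M) W)"
      "B' = D' \<inter> C'" "D' \<in> sets (generated_by (space M) Z)"
      "C' \<in> sets (F (ennreal t)) \<inter> sets (generated_by (space M) W)" by blast
    then show "B \<inter> B' \<in> ?P"
      by (intro CollectI exI[of _ "D \<inter> D'"] exI[of _ "C \<inter> C'"]) auto
  qed
  moreover have "Int_stable {E}" by (simp add: Int_stable_def)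
  ultimately have "indep_set (sigma_sets (space M) ?P) (sigma_sets (space M) {E})"
    by (intro indep_set_sigma_sets)
  then show ?thesis
    using B unfolding sets_joint_history by (intro indep_setD) auto
qed

text \<open>If \<open>A\<close> had positive probability, the steering weight would be compared on
  \<open>A\<close> and on the event \<open>Hc\<close> that \<open>Z\<close> is too rough. It is 0 on
  \<open>A - Hc\<close>, where successful steering contradicts \<open>dev\<close>, and agrees with
  \<open>prob\<close> on both \<open>A\<close> and \<open>Hc\<close>. Hence
  \<open>prob A \<le> prob Hc\<close>, against the choice of the grid.\<close>

lemma sticky:
  assumes "0 \<le> s" "s < T" and A: "A \<in> sets (F (ennreal s))" and "0 < \<epsilon>"
    and dev: "AE \<omega> in M. \<omega> \<in> A \<longrightarrow> (\<exists>t\<in>{s..T}. \<epsilon> \<le> norm (W t \<omega> + Z t \<omega> - (W s \<omega> + Z s \<omega>)))"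
  shows "prob A = 0"
proof (rule ccontr)
  assume "prob A \<noteq> 0"
  then have A_pos: "0 < prob A" by (simp add: zero_less_measure_iff)
  \<comment> \<open>Each coordinate will deviate by at most \<open>2 * (a + sqrt d)\<close>, which
    is less than \<open>5 * a\<close> once \<open>sqrt d < a\<close>; the norm is at most the sum
    over the \<open>CARD('n)\<close> coordinates, hence stays below
    \<open>\<epsilon>\<close>.\<close>
  define a where "a = \<epsilon> / (5 * CARD('n))"
  have "0 < a" using \<open>0 < \<epsilon>\<close> by (simp add: a_def)
  obtain q where q: "0 < q" "\<And>s t x. 0 \<le> s \<Longrightarrow> s < t \<Longrightarrow>
       q \<le> prob {\<omega>\<in>space M. W t \<omega> - W s \<omega> \<in> signed_box (sqrt (t - s)) x}"
    using brownian_increment_signed_box[OF prob_space_axioms brownian_W] by blast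
  define h where "h j = 1 / real (Suc j)" for j
  \<comment> \<open>The number of cells of width \<open>h j\<close> that cover
    \<open>[s, T]\<close>. The overshoot is at most one cell, so every grid ends by
    \<open>T + 1\<close>.\<close>
  define N where "N j = nat \<lceil>(T - s) / h j\<rceil>" for j
  have h: "0 < h j" "h j \<le> 1" for j by (simp_all add: h_def)
  have h_lim: "filterlim h (at_right 0) sequentially"
    unfolding filterlim_at h_def
    by (auto simp del: of_nat_Suc intro!: LIMSEQ_inverse_real_of_nat[unfolded inverse_eq_divide])
  have N: "T \<le> s + real (N j) * h j" "s + real (N j) * h j \<le> T + 1" for j
  proof -
    have "0 \<le> (T - s) / h j" using \<open>s < T\<close> h(1)[of j] by simp
    then have "(T - s) / h j \<le> real (N j)" "real (N j) \<le> (T - s) / h j + 1"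
      unfolding N_def by linarith+
    then show "T \<le> s + real (N j) * h j" "s + real (N j) * h j \<le> T + 1"
      using h[of j] by (auto simp: field_simps)
  qed
  define bad where "bad Y r j = space M -
    (\<Inter>k\<in>{..<N j}. dyadic_event (space M) Y (s + real k * h j) (h j) (cube (r (h j))) UNIV)"
    for Y :: "real \<Rightarrow> 'a \<Rightarrow> real ^ 'n" and r :: "real \<Rightarrow> real" and j
  have "(\<lambda>j. prob (bad W (\<lambda>_. a) j)) \<longlonglongrightarrow> 0"
    unfolding bad_def using AE_W_small \<open>0 < a\<close> h_lim h(1) \<open>0 \<le> s\<close> N(2)
    by (intro prob_bad_grid_tendsto_0 W_measurable) (auto elim: eventually_mono)
  moreover have "AE \<omega> in M. \<forall>U. \<forall>\<^sub>F h in at_right 0. \<forall>s t. 0 \<le> s \<longrightarrow> s \<le> t \<longrightarrow> t \<le> U \<longrightarrow> t - s \<le> h \<longrightarrow>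
      norm (Z t \<omega> - Z s \<omega>) \<le> sqrt h"
    using AE_Z_small
  proof eventually_elim
    case (elim \<omega>)
    show ?case
    proof
      fix U
      show "\<forall>\<^sub>F h in at_right 0. \<forall>s t. 0 \<le> s \<longrightarrow> s \<le> t \<longrightarrow> t \<le> U \<longrightarrow> t - s \<le> h \<longrightarrow>
          norm (Z t \<omega> - Z s \<omega>) \<le> sqrt h"
        using elim[THEN spec, of U, THEN spec, of 1] by simp
    qed
  qed
  then have "(\<lambda>j. prob (bad Z sqrt j)) \<longlonglongrightarrow> 0"
    unfolding bad_def using h_lim h(1) \<open>0 \<le> s\<close> N(2)
    by (intro prob_bad_grid_tendsto_0 Z_measurable) auto
  moreover have "(\<lambda>j. sqrt (h j)) \<longlonglongrightarrow> sqrt 0"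
    using h_lim by (intro tendsto_intros) (simp add: filterlim_at)
  \<comment> \<open>Two different thresholds: a rough \<open>W\<close> less likely than
    \<open>q\<close> leaves positive probability to every steering event, while a rough
    \<open>Z\<close> less likely than \<open>prob A\<close> produces the final
    contradiction.\<close>
  ultimately have "\<forall>\<^sub>F j in sequentially. prob (bad W (\<lambda>_. a) j) < q \<and> prob (bad Z sqrt j) < prob A \<and> sqrt (h j) < a"
    using q(1) A_pos \<open>0 < a\<close> by (intro eventually_conj order_tendstoD(2)[where y=0]) auto
  then obtain j where j: "prob (bad W (\<lambda>_. a) j) < q" "prob (bad Z sqrt j) < prob A" "sqrt (h j) < a"
    using eventually_happens'[OF sequentially_bot] by blast
  define d where "d = h j"
  define n where "n = N j"
  have d: "0 < d" "sqrt d < a" and n: "T \<le> s + real n * d"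
    using h j N(1)[of j] by (simp_all add: d_def n_def)
  define t where "t k = s + real k * d" for k
  have t: "0 \<le> t k" "s \<le> t k" "t (Suc k) = t k + d" "t k < t (Suc k)" for k
    using d \<open>0 \<le> s\<close> by (auto simp: t_def algebra_simps)
  have t0: "t 0 = s" by (simp add: t_def)
  \<comment> \<open>A coordinate is \<open>True\<close> when the process is below its starting value
    there and is to be pushed up; equality counts as a push down.\<close>
  define v where "v k \<omega> = (\<lambda>\<nu>. (W (t k) \<omega> + Z (t k) \<omega>) $ \<nu> < (W s \<omega> + Z s \<omega>) $ \<nu>)" for k \<omega>
  define e where "e k x = dyadic_event (space M) W (t k) d (cube a) (signed_box (sqrt d) x)" for k x
  define Hc where "Hc = bad Z sqrt j"
  have v_meas: "{\<omega>\<in>space M. v k \<omega> = x} \<in> sets N'"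
    if N': "space N' = space M" "W (t k) \<in> borel_measurable N'" "Z (t k) \<in> borel_measurable N'"
      "W s \<in> borel_measurable N'" "Z s \<in> borel_measurable N'" for N' :: "'a measure" and k x
  proof -
    have "{\<omega>\<in>space N'. \<forall>\<nu>\<in>UNIV. ((W (t k) \<omega> + Z (t k) \<omega>) $ \<nu> < (W s \<omega> + Z s \<omega>) $ \<nu>) = x \<nu>} \<in> sets N'"
    proof (intro sets.sets_Collect_finite_All')
      fix \<nu>
      have [measurable]: "(\<lambda>\<omega>. (W (t k) \<omega> + Z (t k) \<omega>) $ \<nu>) \<in> borel_measurable N'"
        "(\<lambda>\<omega>. (W s \<omega> + Z s \<omega>) $ \<nu>) \<in> borel_measurable N'"
        using N' by (auto intro!: borel_measurable_add measurable_vec_nth)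
      show "{\<omega>\<in>space N'. ((W (t k) \<omega> + Z (t k) \<omega>) $ \<nu> < (W s \<omega> + Z s \<omega>) $ \<nu>) = x \<nu>} \<in> sets N'"
        by measurable
    qed auto
    then show ?thesis by (simp add: v_def N'(1) fun_eq_iff)
  qed
  have v_F: "{\<omega>\<in>space M. v k \<omega> = x} \<in> sets (F (ennreal (t k)))" for k x
    using t[of k] \<open>0 \<le> s\<close> by (intro v_meas W_measurable_F Z_measurable_F space_F) auto
  have v_joint: "{\<omega>\<in>space M. v k \<omega> = x} \<in> sets (joint_history (t k))" for k x
    using t[of k] \<open>0 \<le> s\<close> by (intro v_meas W_measurable_joint Z_measurable_joint) auto
  have e_F: "e k x \<in> sets (F (ennreal (t (Suc k))))" for k x
    unfolding e_def space_F[of "ennreal (t (Suc k))", symmetric] using t[of k] d(1)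
    by (intro dyadic_event_measurable W_measurable_F) auto
  have e_W: "e k x \<in> sets (generated_by (space M) W)" for k x
  proof -
    have "dyadic_event (space (generated_by (space M) W)) W (t k) d (cube a) (signed_box (sqrt d) x)
        \<in> sets (generated_by (space M) W)"
      using t(1)[of k] d(1) by (intro dyadic_event_measurable measurable_generated_by) auto
    then show ?thesis by (simp add: e_def)
  qed
  have e_indep: "prob (C \<inter> e k x) = prob C * prob (e k x)" if "C \<in> sets (F (ennreal (t k)))" for C k x
    unfolding e_def using t[of k] d(1) that by (intro dyadic_event_indep) auto
  have e_pos: "0 < prob (e k x)" if "k < n" for k x
  proof -
    let ?B = "{\<omega>\<in>space M. W (t k + d) \<omega> - W (t k) \<omega> \<in> signed_box (sqrt d) x}"
    have bad: "bad W (\<lambda>_. a) j \<in> events"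
      unfolding bad_def using h(1)[of j] t(1)[unfolded t_def d_def] \<open>k < n\<close>
      by (intro sets.Diff sets.finite_INT dyadic_event_measurable W_measurable sets.top)
        (auto simp: n_def intro: order_trans)
    have "q \<le> prob ?B"
      using q(2)[of "t k" "t k + d" x] t[of k] d(1) by simp
    also have "prob ?B \<le> prob (e k x \<union> bad W (\<lambda>_. a) j)"
    proof (rule finite_measure_mono)
      \<comment> \<open>An increment in the box that misses \<open>e k x\<close> must have left the
        cube at a dyadic time of cell \<open>k\<close>, so \<open>W\<close> is rough on the
        grid.\<close>
      show "?B \<subseteq> e k x \<union> bad W (\<lambda>_. a) j"
        using \<open>k < n\<close> by (auto simp: e_def bad_def dyadic_event_def t_def d_def n_def)
      show "e k x \<union> bad W (\<lambda>_. a) j \<in> events"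
        using e_F[of k x] sets_F_subset bad by blast
    qed
    also have "\<dots> \<le> prob (e k x) + prob (bad W (\<lambda>_. a) j)"
      using e_F[of k x] sets_F_subset bad by (intro measure_Un_le) auto
    finally show ?thesis using j(1) by simp
  qed
  interpret steering M v e n
  proof (unfold_locales, goal_cases)
    case (1 k x)
    show ?case by (rule subsetD[OF sets_F_subset v_F])
  next
    case (2 k x)
    show ?case by (rule subsetD[OF sets_F_subset e_F])
  next
    case (3 k x)
    then show ?case by (rule e_pos)
  qed
  have Hc_Z: "Hc \<in> sets (generated_by (space M) Z)"
  proof (cases "n = 0")
    case True
    then show ?thesis
      using sets.top[of "generated_by (space M) Z"] by (simp add: Hc_def bad_def n_def)
  next
    case False
    have "dyadic_event (space M) Z (t k) d (cube (sqrt d)) UNIV \<in> sets (generated_by (space M) Z)" for k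
    proof -
      have "dyadic_event (space (generated_by (space M) Z)) Z (t k) d (cube (sqrt d)) UNIV
          \<in> sets (generated_by (space M) Z)"
        using t(1)[of k] d(1) by (intro dyadic_event_measurable measurable_generated_by) auto
      then show ?thesis by simp
    qed
    moreover have "Hc = space (generated_by (space M) Z) -
        (\<Inter>k\<in>{..<n}. dyadic_event (space M) Z (t k) d (cube (sqrt d)) UNIV)"
      by (simp add: Hc_def bad_def t_def d_def n_def)
    ultimately show ?thesis using False
      by (simp only:) (intro sets.Diff sets.finite_INT sets.top; auto)
  qed
  have Hc_events: "Hc \<in> events" and A_events: "A \<in> events"
    using Hc_Z generated_sets_events A sets_F_subset by blast+
  \<comment> \<open>First filtration: \<open>A\<close> is known at the time \<open>t 0 = s\<close>,
    and each steering event is independent of \<open>F\<close> at the start of its cell.\<close>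
  have "prob A = steered n A"
    using sets_F_subset sets_F_mono[OF ennreal_leI[OF less_imp_le[OF t(4)]]] A t0
    by (intro steered_eq_prob[symmetric, where G="\<lambda>k. sets (F (ennreal (t k)))"] v_F e_F e_indep) auto
  also have "\<dots> \<le> steered n (A - Hc) + steered n Hc"
    using A_events Hc_events by (intro steered_split) auto
  also have "steered n (A - Hc) = 0"
  proof (rule steered_null)
    from dev AE_continuous_W AE_continuous_Z AE_space
    show "AE \<omega> in M. \<omega> \<in> A - Hc \<longrightarrow> (\<exists>k<n. \<omega> \<notin> e k (v k \<omega>))"
    proof eventually_elim
      case (elim \<omega>)
      show ?case
      proof (intro impI, rule ccontr)
        assume \<omega>: "\<omega> \<in> A - Hc" and "\<not> (\<exists>k<n. \<omega> \<notin> e k (v k \<omega>))"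
        then have e: "\<omega> \<in> e k (v k \<omega>)" if "k < n" for k using that by blast
        have z: "\<omega> \<in> dyadic_event (space M) Z (t k) d (cube (sqrt d)) UNIV" if "k < n" for k
          using \<omega> that elim(4) unfolding Hc_def bad_def t_def d_def n_def by blast
        obtain u where u: "u \<in> {s..T}" "\<epsilon> \<le> norm (W u \<omega> + Z u \<omega> - (W s \<omega> + Z s \<omega>))"
          using elim(1) \<omega> by blast
        have "\<bar>(W u \<omega> + Z u \<omega> - (W s \<omega> + Z s \<omega>)) $ \<nu>\<bar> \<le> 2 * (a + sqrt d)" for \<nu>
        proof -
          have cont: "continuous_on {t k..t k + d} (\<lambda>t. W t \<omega> $ \<nu>)"
            "continuous_on {t k..t k + d} (\<lambda>t. Z t \<omega> $ \<nu>)" for k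
            using elim(2,3) t(1)[of k] by (auto intro!: continuous_intros elim!: continuous_on_subset)
          \<comment> \<open>Within a cell \<open>Z\<close> deviates by at most
            \<open>sqrt d\<close>, the least size of a forced Brownian step, so the tracking bound
            applies to each coordinate.\<close>
          have "\<bar>W u \<omega> $ \<nu> + Z u \<omega> $ \<nu> - (W s \<omega> $ \<nu> + Z s \<omega> $ \<nu>)\<bar> \<le> 2 * (a + sqrt d)"
          proof (rule tracking_bound[where h=d and n=n and w="\<lambda>t. W t \<omega> $ \<nu>" and z="\<lambda>t. Z t \<omega> $ \<nu>"];
              (fold t_def)?)
            fix k u assume k: "k < n" and u: "u \<in> {t k..t k + d}"
            show "\<bar>W u \<omega> $ \<nu> - W (t k) \<omega> $ \<nu>\<bar> \<le> a"
              using e[OF k] by (intro dyadic_oscillation[OF cont(1) d(1) _ u])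
                (auto simp: e_def dyadic_event_def cube_def)
            show "\<bar>Z u \<omega> $ \<nu> - Z (t k) \<omega> $ \<nu>\<bar> \<le> sqrt d"
              using z[OF k] by (intro dyadic_oscillation[OF cont(2) d(1) _ u])
                (auto simp: dyadic_event_def cube_def)
          next
            fix k assume k: "k < n"
            have box: "W (t k + d) \<omega> - W (t k) \<omega> \<in> signed_box (sqrt d) (v k \<omega>)"
              using e[OF k] by (simp add: e_def dyadic_event_def)
            show "sqrt d \<le> W (t k + d) \<omega> $ \<nu> - W (t k) \<omega> $ \<nu>"
              if "W (t k) \<omega> $ \<nu> + Z (t k) \<omega> $ \<nu> < W s \<omega> $ \<nu> + Z s \<omega> $ \<nu>"
              using signed_box_bounds(1)[OF box, of \<nu>] d(1) that by (simp add: v_def)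
            show "W (t k + d) \<omega> $ \<nu> - W (t k) \<omega> $ \<nu> \<le> - sqrt d"
              if "W s \<omega> $ \<nu> + Z s \<omega> $ \<nu> \<le> W (t k) \<omega> $ \<nu> + Z (t k) \<omega> $ \<nu>"
              using signed_box_bounds(2)[OF box, of \<nu>] d(1) that by (simp add: v_def)
          qed (use d(1) \<open>0 < a\<close> u n in \<open>auto simp: t_def\<close>)
          then show ?thesis by simp
        qed
        then have "norm (W u \<omega> + Z u \<omega> - (W s \<omega> + Z s \<omega>)) \<le> (\<Sum>\<nu>\<in>(UNIV :: 'n set). 2 * (a + sqrt d))"
          by (intro order_trans[OF norm_le_l1_cart] sum_mono)
        also have "\<dots> < (\<Sum>\<nu>\<in>(UNIV :: 'n set). 5 * a)"
          using d \<open>0 < a\<close> by (intro sum_strict_mono) auto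
        also have "\<dots> = \<epsilon>" by (simp add: a_def)
        finally show False using u(2) by simp
      qed
    qed
  qed simp
  \<comment> \<open>Second filtration: the joint history knows all of \<open>Z\<close>, hence
    \<open>Hc\<close>, from the start, and still leaves the steering events independent.\<close>
  also have "steered n Hc = prob Hc"
  proof (rule steered_eq_prob[where G="\<lambda>k. sets (joint_history (t k))"])
    show "Hc \<in> sets (joint_history (t 0))"
      by (rule subsetD[OF generated_Z_joint Hc_Z])
    show "sets (joint_history (t k)) \<subseteq> sets (joint_history (t (Suc k)))" for k
      using t(4)[of k] by (intro joint_history_mono) simp
    show "prob (C \<inter> e k x) = prob C * prob (e k x)" if "C \<in> sets (joint_history (t k))" for C k x
      using e_W e_indep that by (rule joint_history_indep)
  qed (auto intro: v_joint sets.Int F_generated_W_joint[OF e_F e_W] subsetD[OF joint_history_events])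
  finally show False using j(2) by (simp add: Hc_def)
qed

end

section \<open>Simple strategies\<close>

context usual_filtered_prob_space
begin

text \<open>Trading times capped at a horizon are real-valued, which calls for a real index set. At
  negative indices \<open>ennreal t\<close> is 0 and the filtration is constantly
  \<open>F 0\<close>.\<close>

sublocale rt: filtration "space M" "\<lambda>t::real. F (ennreal t)"
  by unfold_locales (rule space_F, rule sets_F_mono[OF ennreal_leI])

text \<open>By completeness every subset of a null set is a null set, and all null sets belong to
  \<open>F 0\<close>; altering \<open>f\<close> on a null set therefore stays within
  \<open>F t\<close>.\<close>

lemma borel_measurable_F_AE_eq:
  assumes f: "f \<in> borel_measurable (F t)" and eq: "AE \<omega> in M. f \<omega> = g \<omega>"
  shows "g \<in> borel_measurable (F t)"
proof (rule measurableI)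
  fix B :: "'b set" assume B: "B \<in> sets borel"
  from eq obtain N where N: "{\<omega>\<in>space M. f \<omega> \<noteq> g \<omega>} \<subseteq> N" "N \<in> null_sets M"
    by (auto elim!: AE_E simp: null_setsI)
  have "N \<inter> g -` B \<in> null_sets M"
    by (rule complete2[OF _ N(2)]) auto
  then have "N \<in> sets (F t)" "N \<inter> g -` B \<in> sets (F t)"
    using N(2) null_sets_F_0 sets_F_mono[of 0 t] by auto
  moreover have "f -` B \<inter> space (F t) \<in> sets (F t)"
    using f B by (rule measurable_sets)
  ultimately have "(f -` B \<inter> space (F t) - N) \<union> (N \<inter> g -` B) \<in> sets (F t)"
    by blast
  also have "(f -` B \<inter> space (F t) - N) \<union> (N \<inter> g -` B) = g -` B \<inter> space (F t)"
    using N(1) N(2)[THEN null_setsD2, THEN sets.sets_into_space] by (auto simp: space_F)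
  finally show "g -` B \<inter> space (F t) \<in> sets (F t)" .
qed simp

text \<open>\<open>X\<close> is read off at grid times not before
  \<open>min (\<rho> \<omega>) t\<close>, capped at \<open>t\<close> so that only values known at
  time \<open>t\<close> occur. Paths are continuous only almost surely, so the limit is identified
  only almost surely, which the completed filtration permits.\<close>

lemma stopped_process_measurable:
  fixes X :: "real \<Rightarrow> 'a \<Rightarrow> 'b::euclidean_space"
  assumes X: "adapted F X" "AE \<omega> in M. continuous_on {0..} (\<lambda>t. X t \<omega>)"
    and \<rho>: "stopping_time (\<lambda>t::real. F (ennreal t)) \<rho>" "\<And>\<omega>. 0 \<le> \<rho> \<omega>" and "0 \<le> t"
  shows "(\<lambda>\<omega>. X (min (\<rho> \<omega>) t) \<omega>) \<in> borel_measurable (F (ennreal t))"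
proof -
  have min_meas [measurable]: "(\<lambda>\<omega>. min (\<rho> \<omega>) t) \<in> borel_measurable (F (ennreal t))"
  proof (rule borel_measurableI_le)
    fix u
    show "{\<omega>\<in>space (F (ennreal t)). min (\<rho> \<omega>) t \<le> u} \<in> sets (F (ennreal t))"
    proof (cases "t \<le> u")
      case False
      then have "{\<omega>\<in>space (F (ennreal t)). min (\<rho> \<omega>) t \<le> u} = {\<omega>\<in>space (F (ennreal t)). \<rho> \<omega> \<le> u}"
        by auto
      also have "\<dots> \<in> sets (F (ennreal t))"
        using rt.stopping_time_le_const[OF \<rho>(1), of u t] False by (simp add: pred_def)
      finally show ?thesis .
    qed (simp add: min.coboundedI2)
  qed
  define r where "r i k = min t ((real k + 1) / real (Suc i))" for i k :: nat
  define g where "g i \<omega> = nat \<lfloor>real (Suc i) * min (\<rho> \<omega>) t\<rfloor>" for i \<omega>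
  have r_meas: "X (r i k) \<in> borel_measurable (F (ennreal t))" for i k
  proof -
    have "0 \<le> r i k" "r i k \<le> t" using \<open>0 \<le> t\<close> by (auto simp: r_def)
    then have "X (r i k) \<in> borel_measurable (F (ennreal (r i k)))"
      using X(1) by (simp add: adapted_def)
    then show ?thesis
      using sets_F_mono[OF ennreal_leI[OF \<open>r i k \<le> t\<close>]] by (auto simp: measurable_def space_F)
  qed
  have "(\<lambda>\<omega>. X (r i (g i \<omega>)) \<omega>) \<in> borel_measurable (F (ennreal t))" for i
  proof (rule measurable_compose_countable[OF r_meas])
    show "g i \<in> measurable (F (ennreal t)) (count_space UNIV)"
      unfolding g_def by measurable
  qed
  then have lim_meas: "(\<lambda>\<omega>. lim (\<lambda>i. X (r i (g i \<omega>)) \<omega>)) \<in> borel_measurable (F (ennreal t))"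
    by (rule borel_measurable_lim_metric)
  moreover have "AE \<omega> in M. lim (\<lambda>i. X (r i (g i \<omega>)) \<omega>) = X (min (\<rho> \<omega>) t) \<omega>"
    using X(2)
  proof eventually_elim
    case (elim \<omega>)
    let ?x = "min (\<rho> \<omega>) t"
    have x: "0 \<le> ?x" "?x \<le> t" using \<rho>(2)[of \<omega>] \<open>0 \<le> t\<close> by auto
    have r: "?x \<le> r i (g i \<omega>)" "r i (g i \<omega>) \<le> ?x + 1 / real (Suc i)" for i
    proof -
      have "0 \<le> real (Suc i) * ?x" using x by simp
      then have "real (g i \<omega>) = of_int \<lfloor>real (Suc i) * ?x\<rfloor>"
        unfolding g_def by simp
      then have "real (Suc i) * ?x \<le> real (g i \<omega>) + 1" "real (g i \<omega>) \<le> real (Suc i) * ?x"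
        by linarith+
      then have "?x \<le> (real (g i \<omega>) + 1) / real (Suc i)" "real (g i \<omega>) / real (Suc i) \<le> ?x"
        using pos_le_divide_eq[of "real (Suc i)" ?x "real (g i \<omega>) + 1"]
          pos_divide_le_eq[of "real (Suc i)" "real (g i \<omega>)" ?x]
        by (simp_all only: mult.commute of_nat_0_less_iff zero_less_Suc)
      then show "?x \<le> r i (g i \<omega>)" "r i (g i \<omega>) \<le> ?x + 1 / real (Suc i)"
        unfolding r_def by (auto simp: add_divide_distrib simp del: of_nat_Suc)
    qed
    have "(\<lambda>i. ?x + 1 / real (Suc i)) \<longlonglongrightarrow> ?x + 0"
      by (intro tendsto_intros LIMSEQ_inverse_real_of_nat[unfolded inverse_eq_divide])
    then have "(\<lambda>i. ?x + 1 / real (Suc i)) \<longlonglongrightarrow> ?x"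
      unfolding add_0_right .
    then have "(\<lambda>i. r i (g i \<omega>)) \<longlonglongrightarrow> ?x"
      by (rule tendsto_sandwich[OF always_eventually always_eventually tendsto_const, rotated 2])
        (use r in blast)+
    moreover have "0 \<le> r i (g i \<omega>)" for i using x(1) r(1)[of i] by linarith
    ultimately have "(\<lambda>i. X (r i (g i \<omega>)) \<omega>) \<longlonglongrightarrow> X ?x \<omega>"
      using x by (intro continuous_on_tendsto_compose[OF elim]) auto
    then show ?case by (rule limI)
  qed
  ultimately show ?thesis by (rule borel_measurable_F_AE_eq)
qed

lemma process_at_stopping_time_measurable:
  fixes X :: "real \<Rightarrow> 'a \<Rightarrow> 'b::euclidean_space"
  assumes X: "adapted F X" "AE \<omega> in M. continuous_on {0..} (\<lambda>t. X t \<omega>)"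
    and \<rho>: "stopping_time (\<lambda>t::real. F (ennreal t)) \<rho>" "\<And>\<omega>. 0 \<le> \<rho> \<omega>"
  shows "(\<lambda>\<omega>. X (\<rho> \<omega>) \<omega>) \<in> borel_measurable (rt.pre_sigma \<rho>)"
proof (rule measurableI)
  fix B :: "'b set" assume B: "B \<in> sets borel"
  show "(\<lambda>\<omega>. X (\<rho> \<omega>) \<omega>) -` B \<inter> space (rt.pre_sigma \<rho>) \<in> sets (rt.pre_sigma \<rho>)"
  proof (rule rt.sets_pre_sigmaI[OF \<rho>(1)])
    fix t :: real
    show "{\<omega> \<in> (\<lambda>\<omega>. X (\<rho> \<omega>) \<omega>) -` B \<inter> space (rt.pre_sigma \<rho>). \<rho> \<omega> \<le> t} \<in> sets (F (ennreal t))"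
    proof (cases "0 \<le> t")
      case True
      have [measurable]: "(\<lambda>\<omega>. X (min (\<rho> \<omega>) t) \<omega>) \<in> borel_measurable (F (ennreal t))"
        using X \<rho> True by (rule stopped_process_measurable)
      have [measurable]: "Measurable.pred (F (ennreal t)) (\<lambda>\<omega>. \<rho> \<omega> \<le> t)"
        using \<rho>(1) by (rule stopping_timeD)
      have "{\<omega>\<in>space (F (ennreal t)). X (min (\<rho> \<omega>) t) \<omega> \<in> B \<and> \<rho> \<omega> \<le> t} \<in> sets (F (ennreal t))"
        using B by measurable
      also have "{\<omega>\<in>space (F (ennreal t)). X (min (\<rho> \<omega>) t) \<omega> \<in> B \<and> \<rho> \<omega> \<le> t} =
          {\<omega> \<in> (\<lambda>\<omega>. X (\<rho> \<omega>) \<omega>) -` B \<inter> space (rt.pre_sigma \<rho>). \<rho> \<omega> \<le> t}"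
        by (auto simp: space_F rt.space_pre_sigma min_absorb1)
      finally show ?thesis .
    next
      case False
      then have "\<not> \<rho> \<omega> \<le> t" for \<omega> using \<rho>(2)[of \<omega>] by linarith
      then show ?thesis by simp
    qed
  qed
qed simp

text \<open>This turns quantities known at \<open>\<rho>\<close> into ones known at a fixed time
  \<open>t\<close>, with an arbitrary default \<open>c\<close> where \<open>\<rho>\<close> has not
  yet occurred.\<close>

lemma measurable_pre_sigma_restrict:
  fixes f :: "'a \<Rightarrow> 'b::topological_space"
  assumes \<rho>: "stopping_time (\<lambda>t::real. F (ennreal t)) \<rho>" and f: "f \<in> borel_measurable (rt.pre_sigma \<rho>)"
  shows "(\<lambda>\<omega>. if \<rho> \<omega> \<le> t then f \<omega> else c) \<in> borel_measurable (F (ennreal t))"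
proof (rule measurableI)
  fix B :: "'b set" assume B: "B \<in> sets borel"
  have "{\<omega> \<in> f -` B \<inter> space (rt.pre_sigma \<rho>). \<rho> \<omega> \<le> t} \<in> sets (F (ennreal t))"
    using measurable_sets[OF f B] by (rule rt.sets_pre_sigmaD[OF \<rho>])
  moreover have "{\<omega>\<in>space (F (ennreal t)). \<not> \<rho> \<omega> \<le> t} \<in> sets (F (ennreal t))"
    using stopping_timeD[OF \<rho>, of t] by measurable
  moreover have "(\<lambda>\<omega>. if \<rho> \<omega> \<le> t then f \<omega> else c) -` B \<inter> space (F (ennreal t)) =
      {\<omega> \<in> f -` B \<inter> space (rt.pre_sigma \<rho>). \<rho> \<omega> \<le> t} \<union>
      (if c \<in> B then {\<omega>\<in>space (F (ennreal t)). \<not> \<rho> \<omega> \<le> t} else {})"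
    by (auto simp: rt.space_pre_sigma space_F split: if_splits)
  ultimately show "(\<lambda>\<omega>. if \<rho> \<omega> \<le> t then f \<omega> else c) -` B \<inter> space (F (ennreal t)) \<in> sets (F (ennreal t))"
    by auto
qed simp

end

section \<open>Absence of arbitrage from stickiness and two-way crossing\<close>

locale sticky_crossing_market = usual_filtered_prob_space M F
  for M :: "'a measure" and F +
  fixes X :: "real \<Rightarrow> 'a \<Rightarrow> real ^ 'd"
  assumes adapted_X: "adapted F X"
    and AE_continuous_X: "AE \<omega> in M. continuous_on {0..} (\<lambda>t. X t \<omega>)"
    and sticky_X: "\<And>s T A \<epsilon>. 0 \<le> s \<Longrightarrow> s < T \<Longrightarrow> A \<in> sets (F (ennreal s)) \<Longrightarrow> 0 < \<epsilon> \<Longrightarrow>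
      AE \<omega> in M. \<omega> \<in> A \<longrightarrow> (\<exists>t\<in>{s..T}. \<epsilon> \<le> norm (X t \<omega> - X s \<omega>)) \<Longrightarrow> prob A = 0"
    and crossing_X: "\<And>\<rho> A \<psi>. stopping_time (\<lambda>t::real. F (ennreal t)) \<rho> \<Longrightarrow> (\<And>\<omega>. 0 \<le> \<rho> \<omega>) \<Longrightarrow>
      A \<in> sets (filtration.pre_sigma (space M) (\<lambda>t::real. F (ennreal t)) \<rho>) \<Longrightarrow>
      \<psi> \<in> borel_measurable (filtration.pre_sigma (space M) (\<lambda>t::real. F (ennreal t)) \<rho>) \<Longrightarrow>
      AE \<omega> in M. \<omega> \<in> A \<longrightarrow> \<psi> \<omega> \<noteq> 0 \<and> (\<exists>u>\<rho> \<omega>. \<forall>t\<in>{\<rho> \<omega>..<u}. 0 \<le> \<psi> \<omega> \<bullet> (X t \<omega> - X (\<rho> \<omega>) \<omega>)) \<Longrightarrow>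
      prob A = 0"
begin

text \<open>Suppose that at a fixed time \<open>t\<close> within the period the wealth is below
  \<open>- 1 / (k + 1)\<close> and the holdings have norm at most \<open>k + 1\<close>. To end
  nonnegative, prices must still move by \<open>1 / (k + 1)^2\<close>; as this event is known at
  \<open>t\<close>, stickiness makes it null. Countably many \<open>k\<close> and rational
  \<open>t\<close> suffice by continuity of paths.\<close>

lemma wealth_nonneg_before_end:
  assumes \<rho>: "stopping_time (\<lambda>t::real. F (ennreal t)) \<rho>" "\<And>\<omega>. 0 \<le> \<rho> \<omega>"
    and \<rho>': "stopping_time (\<lambda>t::real. F (ennreal t)) \<rho>'" "\<And>\<omega>. \<rho>' \<omega> \<le> T"
    and V: "V \<in> borel_measurable (rt.pre_sigma \<rho>)" and \<phi>: "\<phi> \<in> borel_measurable (rt.pre_sigma \<rho>)"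
    and nonneg: "AE \<omega> in M. 0 \<le> V \<omega> + \<phi> \<omega> \<bullet> (X (\<rho>' \<omega>) \<omega> - X (\<rho> \<omega>) \<omega>)"
  shows "AE \<omega> in M. \<forall>t. \<rho> \<omega> \<le> t \<longrightarrow> t < \<rho>' \<omega> \<longrightarrow> 0 \<le> V \<omega> + \<phi> \<omega> \<bullet> (X t \<omega> - X (\<rho> \<omega>) \<omega>)"
proof -
  have "AE \<omega> in M. \<not> (\<rho> \<omega> \<le> t \<and> t < \<rho>' \<omega> \<and>
      V \<omega> + \<phi> \<omega> \<bullet> (X t \<omega> - X (\<rho> \<omega>) \<omega>) < - 1 / (real k + 1) \<and> norm (\<phi> \<omega>) \<le> real k + 1)"
    if "0 \<le> t" "t < T" for t and k :: nat
  proof -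
    \<comment> \<open>Truncation makes the data of the period measurable at time \<open>t\<close>;
      on \<open>?A\<close> it changes nothing, as \<open>\<rho> \<omega> \<le> t\<close>
      there.\<close>
    let ?r = "\<lambda>f \<omega>. if \<rho> \<omega> \<le> t then f \<omega> else 0"
    let ?A = "{\<omega>\<in>space M. \<rho> \<omega> \<le> t \<and> \<not> \<rho>' \<omega> \<le> t \<and>
      V \<omega> + \<phi> \<omega> \<bullet> (X t \<omega> - X (\<rho> \<omega>) \<omega>) < - 1 / (real k + 1) \<and> norm (\<phi> \<omega>) \<le> real k + 1}"
    have [measurable]: "Measurable.pred (F (ennreal t)) (\<lambda>\<omega>. \<rho> \<omega> \<le> t)"
      "Measurable.pred (F (ennreal t)) (\<lambda>\<omega>. \<rho>' \<omega> \<le> t)"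
      using stopping_timeD[OF \<rho>(1)] stopping_timeD[OF \<rho>'(1)] by auto
    have [measurable]: "?r V \<in> borel_measurable (F (ennreal t))" "?r \<phi> \<in> borel_measurable (F (ennreal t))"
      "?r (\<lambda>\<omega>. X (\<rho> \<omega>) \<omega>) \<in> borel_measurable (F (ennreal t))"
      using V \<phi> process_at_stopping_time_measurable[OF adapted_X AE_continuous_X \<rho>]
      by (auto intro!: measurable_pre_sigma_restrict[OF \<rho>(1)])
    have [measurable]: "X t \<in> borel_measurable (F (ennreal t))"
      using adapted_X \<open>0 \<le> t\<close> by (simp add: adapted_def)
    have "{\<omega>\<in>space (F (ennreal t)). \<rho> \<omega> \<le> t \<and> \<not> \<rho>' \<omega> \<le> t \<and>
      ?r V \<omega> + ?r \<phi> \<omega> \<bullet> (X t \<omega> - ?r (\<lambda>\<omega>. X (\<rho> \<omega>) \<omega>) \<omega>) < - 1 / (real k + 1) \<and> norm (?r \<phi> \<omega>) \<le> real k + 1}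
      \<in> sets (F (ennreal t))"
      by measurable
    also have "{\<omega>\<in>space (F (ennreal t)). \<rho> \<omega> \<le> t \<and> \<not> \<rho>' \<omega> \<le> t \<and>
      ?r V \<omega> + ?r \<phi> \<omega> \<bullet> (X t \<omega> - ?r (\<lambda>\<omega>. X (\<rho> \<omega>) \<omega>) \<omega>) < - 1 / (real k + 1) \<and> norm (?r \<phi> \<omega>) \<le> real k + 1}
      = ?A"
      by (auto simp: space_F)
    finally have A: "?A \<in> sets (F (ennreal t))" .
    have "prob ?A = 0"
    proof (rule sticky_X[OF \<open>0 \<le> t\<close> \<open>t < T\<close> A])
      show "0 < 1 / (real k + 1)\<^sup>2" by simp
      from nonneg show "AE \<omega> in M. \<omega> \<in> ?A \<longrightarrow> (\<exists>s\<in>{t..T}. 1 / (real k + 1)\<^sup>2 \<le> norm (X s \<omega> - X t \<omega>))"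
      proof eventually_elim
        case (elim \<omega>)
        show ?case
        proof
          assume \<omega>: "\<omega> \<in> ?A"
          let ?y = "X (\<rho>' \<omega>) \<omega> - X t \<omega>"
          have "1 / (real k + 1) \<le> \<phi> \<omega> \<bullet> ?y"
            using \<omega> elim by (auto simp: inner_diff_right)
          also have "\<dots> \<le> norm (\<phi> \<omega>) * norm ?y" by (rule norm_cauchy_schwarz)
          also have "\<dots> \<le> (real k + 1) * norm ?y"
            using \<omega> by (intro mult_right_mono) auto
          finally have "1 / (real k + 1)\<^sup>2 \<le> norm ?y"
            using pos_divide_le_eq[of "real k + 1" "1 / (real k + 1)" "norm ?y"]
            by (simp add: power2_eq_square mult.commute)
          then show "\<exists>s\<in>{t..T}. 1 / (real k + 1)\<^sup>2 \<le> norm (X s \<omega> - X t \<omega>)"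
            using \<omega> \<rho>'(2)[of \<omega>] by (intro bexI[of _ "\<rho>' \<omega>"]) auto
        qed
      qed
    qed
    moreover have "?A \<in> events" using A sets_F_subset by blast
    ultimately have "AE \<omega> in M. \<omega> \<notin> ?A" by (simp only: prob_eq_0)
    with AE_space show ?thesis by eventually_elim auto
  qed
  then have "AE \<omega> in M. \<forall>k. \<forall>t\<in>{t \<in> \<rat>. 0 \<le> t \<and> t < T}. \<not> (\<rho> \<omega> \<le> t \<and> t < \<rho>' \<omega> \<and>
      V \<omega> + \<phi> \<omega> \<bullet> (X t \<omega> - X (\<rho> \<omega>) \<omega>) < - 1 / (real k + 1) \<and> norm (\<phi> \<omega>) \<le> real k + 1)"
    unfolding AE_all_countable
    by (intro allI AE_ball_countable[THEN iffD2] countable_subset[OF _ countable_rat]) auto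
  then show ?thesis
    using AE_continuous_X
  proof eventually_elim
    case (elim \<omega>)
    show ?case
    proof (intro allI impI, rule ccontr)
      fix t assume t: "\<rho> \<omega> \<le> t" "t < \<rho>' \<omega>" and neg: "\<not> 0 \<le> V \<omega> + \<phi> \<omega> \<bullet> (X t \<omega> - X (\<rho> \<omega>) \<omega>)"
      let ?f = "\<lambda>t. V \<omega> + \<phi> \<omega> \<bullet> (X t \<omega> - X (\<rho> \<omega>) \<omega>)"
      have "0 \<le> t" using \<rho>(2)[of \<omega>] t by simp
      have "continuous_on {0..} ?f"
        using elim(2) by (intro continuous_intros)
      then have "(?f \<longlongrightarrow> ?f t) (at t within {0..})"
        using \<open>0 \<le> t\<close> by (simp add: continuous_on_def)
      then have "\<forall>\<^sub>F s in at t within {0..}. ?f s < 0"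
        using neg by (intro order_tendstoD(2)) auto
      then obtain d where d: "0 < d" "\<And>s. 0 \<le> s \<Longrightarrow> s \<noteq> t \<Longrightarrow> dist s t < d \<Longrightarrow> ?f s < 0"
        unfolding eventually_at by auto
      have "t < min (t + d) (\<rho>' \<omega>)" using d t by simp
      then obtain s where s: "s \<in> \<rat>" "t < s" "s < min (t + d) (\<rho>' \<omega>)"
        using Rats_dense_in_real by blast
      have "?f s < 0"
        using s \<open>0 \<le> t\<close> by (intro d(2)) (auto simp: dist_real_def)
      then obtain k1 :: nat where k1: "inverse (real (Suc k1)) < - ?f s"
        using reals_Archimedean[of "- ?f s"] by auto
      obtain k2 :: nat where k2: "norm (\<phi> \<omega>) \<le> real k2" using real_arch_simple by blast
      define k where "k = max k1 k2"
      have "1 / (real k + 1) \<le> inverse (real (Suc k1))"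
        unfolding inverse_eq_divide by (intro divide_left_mono) (auto simp: k_def)
      with k1 have "?f s < - 1 / (real k + 1)" by (simp add: minus_divide_left[symmetric])
      moreover have "norm (\<phi> \<omega>) \<le> real k + 1" using k2 by (simp add: k_def)
      moreover have "s \<in> {t \<in> \<rat>. 0 \<le> t \<and> t < T}" "\<rho> \<omega> \<le> s" "s < \<rho>' \<omega>"
        using s t \<open>0 \<le> t\<close> \<rho>'(2)[of \<omega>] by auto
      ultimately show False using elim(1) by blast
    qed
  qed
qed

text \<open>Induction on the number of periods. Nonnegativity at the start of the last period admits
  the induction hypothesis, so the earlier wealth vanishes; then the gain of the last period alone
  is nonnegative right after its start, and crossing leaves no holdings there unless the period is
  empty.\<close>

lemma wealth_zero:
  assumes \<rho>: "\<And>j. j \<le> n \<Longrightarrow> stopping_time (\<lambda>t::real. F (ennreal t)) (\<rho> j)"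
      "\<And>j \<omega>. 0 \<le> \<rho> j \<omega>" "\<And>j \<omega>. \<rho> j \<omega> \<le> T"
      "\<And>j \<omega>. \<omega> \<in> space M \<Longrightarrow> j < n \<Longrightarrow> \<rho> j \<omega> \<le> \<rho> (Suc j) \<omega>"
    and \<phi>: "\<And>j. j < n \<Longrightarrow> \<phi> j \<in> borel_measurable (rt.pre_sigma (\<rho> j))"
    and nonneg: "AE \<omega> in M. 0 \<le> (\<Sum>j<n. \<phi> j \<omega> \<bullet> (X (\<rho> (Suc j) \<omega>) \<omega> - X (\<rho> j \<omega>) \<omega>))"
  shows "AE \<omega> in M. (\<Sum>j<n. \<phi> j \<omega> \<bullet> (X (\<rho> (Suc j) \<omega>) \<omega> - X (\<rho> j \<omega>) \<omega>)) = 0"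
  using assms
proof (induction n)
  case (Suc n)
  let ?V = "\<lambda>\<omega>. \<Sum>j<n. \<phi> j \<omega> \<bullet> (X (\<rho> (Suc j) \<omega>) \<omega> - X (\<rho> j \<omega>) \<omega>)"
  have le: "\<rho> i \<omega> \<le> \<rho> j \<omega>" if "i \<le> j" "j \<le> Suc n" "\<omega> \<in> space M" for i j \<omega>
    using that
  proof (induction rule: dec_induct)
    case (step k)
    then show ?case using Suc.prems(4)[of \<omega> k] by simp
  qed simp
  have pre_le: "f \<in> borel_measurable (rt.pre_sigma (\<rho> j)) \<Longrightarrow> f \<in> borel_measurable (rt.pre_sigma (\<rho> n))"
    if "j \<le> n" for j and f :: "'a \<Rightarrow> real ^ 'd"
    using rt.mono_pre_sigma[OF Suc.prems(1)[of j] Suc.prems(1)[of n] le] that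
    by (auto simp: measurable_def rt.space_pre_sigma)
  have X_meas: "(\<lambda>\<omega>. X (\<rho> j \<omega>) \<omega>) \<in> borel_measurable (rt.pre_sigma (\<rho> n))" if "j \<le> n" for j
    using that Suc.prems(1,2)
    by (intro pre_le[OF that] process_at_stopping_time_measurable adapted_X AE_continuous_X) auto
  have V_meas: "?V \<in> borel_measurable (rt.pre_sigma (\<rho> n))"
    using Suc.prems(5) by (intro borel_measurable_sum borel_measurable_inner borel_measurable_diff X_meas)
      (auto intro!: pre_le[OF less_imp_le])
  have all: "AE \<omega> in M. \<forall>t. \<rho> n \<omega> \<le> t \<longrightarrow> t < \<rho> (Suc n) \<omega> \<longrightarrow> 0 \<le> ?V \<omega> + \<phi> n \<omega> \<bullet> (X t \<omega> - X (\<rho> n \<omega>) \<omega>)"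
    using Suc.prems V_meas by (intro wealth_nonneg_before_end) auto
  have "AE \<omega> in M. 0 \<le> ?V \<omega>"
    using all Suc.prems(6) AE_space
  proof eventually_elim
    case (elim \<omega>)
    show ?case
    \<comment> \<open>The wealth bound covers only times strictly before the end of the period; in
      an empty period the final wealth is already the wealth at its start.\<close>
    proof (cases "\<rho> n \<omega> < \<rho> (Suc n) \<omega>")
      case True
      with elim(1)[THEN spec, of "\<rho> n \<omega>"] show ?thesis by simp
    next
      case False
      with Suc.prems(4)[OF elim(3), of n] have "\<rho> n \<omega> = \<rho> (Suc n) \<omega>" by simp
      with elim(2) show ?thesis by simp
    qed
  qed
  with Suc.prems have V0: "AE \<omega> in M. ?V \<omega> = 0"
    by (intro Suc.IH) auto
  let ?A = "{\<omega>\<in>space (rt.pre_sigma (\<rho> n)). \<rho> n \<omega> < \<rho> (Suc n) \<omega> \<and> \<phi> n \<omega> \<noteq> 0}"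
  have A: "?A \<in> sets (rt.pre_sigma (\<rho> n))"
  proof -
    have [measurable]: "Measurable.pred (rt.pre_sigma (\<rho> n)) (\<lambda>\<omega>. \<rho> n \<omega> < \<rho> (Suc n) \<omega>)"
      using Suc.prems(1) by (intro rt.stopping_time_less) auto
    have [measurable]: "\<phi> n \<in> borel_measurable (rt.pre_sigma (\<rho> n))"
      using Suc.prems(5) by simp
    show ?thesis by measurable
  qed
  have "prob ?A = 0"
  proof (rule crossing_X[OF _ _ A])
    show "AE \<omega> in M. \<omega> \<in> ?A \<longrightarrow> \<phi> n \<omega> \<noteq> 0 \<and>
        (\<exists>u>\<rho> n \<omega>. \<forall>t\<in>{\<rho> n \<omega>..<u}. 0 \<le> \<phi> n \<omega> \<bullet> (X t \<omega> - X (\<rho> n \<omega>) \<omega>))"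
      using all V0
    proof eventually_elim
      case (elim \<omega>)
      then show ?case by (auto intro!: exI[of _ "\<rho> (Suc n) \<omega>"])
    qed
  qed (use Suc.prems in auto)
  \<comment> \<open>Evaluated at the time \<open>T\<close>, by which \<open>\<rho> n\<close> has
    occurred everywhere, the event lies in \<open>F\<close> at time \<open>T\<close>.\<close>
  moreover have "?A \<in> events"
    using rt.sets_pre_sigmaD[OF Suc.prems(1)[of n] A, of T] sets_F_subset Suc.prems(3) by auto
  ultimately have "AE \<omega> in M. \<omega> \<notin> ?A" by (simp add: prob_eq_0)
  then show ?case
    using V0 AE_space
  proof eventually_elim
    case (elim \<omega>)
    then show ?case
      using Suc.prems(4)[of \<omega> n] by (cases "\<phi> n \<omega> = 0") (auto simp: rt.space_pre_sigma)
  qed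
qed simp

text \<open>Capping the trading times at \<open>T\<close> yields bounded real stopping times of the
  unstopped filtration with the same holdings and, almost surely, the same terminal wealth, so
  \<open>wealth_zero\<close> applies.\<close>

lemma free_of_simple_arbitrage: "free_of_simple_arbitrage_on_finite_horizons M F X"
  unfolding free_of_simple_arbitrage_on_finite_horizons_def
proof (intro allI impI notI)
  fix T :: real assume "0 < T"
  assume "\<exists>n \<tau> \<phi>. simple_arbitrage M (\<lambda>t. F (min t (ennreal T))) (\<lambda>t. X (min t T)) n \<tau> \<phi>"
  then obtain n \<tau> \<phi> where arb: "simple_arbitrage M (\<lambda>t. F (min t (ennreal T))) (\<lambda>t. X (min t T)) n \<tau> \<phi>"
    by blast
  define G where "G t = F (min t (ennreal T))" for t
  interpret G: filtration "space M" G
    unfolding G_def by unfold_locales (rule space_F, rule sets_F_mono, rule min.mono, simp_all)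
  have \<tau>: "\<And>j. j \<le> n \<Longrightarrow> stopping_time G (\<tau> j)" "\<And>j. j \<le> n \<Longrightarrow> AE \<omega> in M. \<tau> j \<omega> < \<infinity>"
      "\<And>j \<omega>. \<omega> \<in> space M \<Longrightarrow> j < n \<Longrightarrow> \<tau> j \<omega> \<le> \<tau> (Suc j) \<omega>"
    and \<phi>: "\<And>j. j < n \<Longrightarrow> \<phi> j \<in> borel_measurable (G.pre_sigma (\<tau> j))"
    and wealth: "AE \<omega> in M. 0 \<le> terminal_wealth (\<lambda>t. X (min t T)) n \<tau> \<phi> \<omega>"
      "0 < prob {\<omega>\<in>space M. 0 < terminal_wealth (\<lambda>t. X (min t T)) n \<tau> \<phi> \<omega>}"
    using arb unfolding simple_arbitrage_def simple_strategy_def G_def by blast+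
  define \<rho> where "\<rho> j \<omega> = enn2real (min (\<tau> j \<omega>) (ennreal T))" for j \<omega>
  have ennreal_\<rho>: "ennreal (\<rho> j \<omega>) = min (\<tau> j \<omega>) (ennreal T)" for j \<omega>
    unfolding \<rho>_def by (intro ennreal_enn2real) (simp add: min_less_iff_disj)
  have \<rho>_bounds: "0 \<le> \<rho> j \<omega>" "\<rho> j \<omega> \<le> T" for j \<omega>
    using ennreal_\<rho>[of j \<omega>] \<open>0 < T\<close> by (simp_all add: \<rho>_def enn2real_leI)
  have \<rho>_le: "\<rho> j \<omega> \<le> t \<longleftrightarrow> \<tau> j \<omega> \<le> ennreal t" if "0 \<le> t" "t < T" for j \<omega> t
    using ennreal_\<rho>[of j \<omega>] that \<rho>_bounds[of j \<omega>]
    by (metis ennreal_le_iff min_le_iff_disj not_le order_less_le_trans ennreal_less_iff)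
  have G_eq: "G t = F t" if "t \<le> ennreal T" for t
    using that by (simp add: G_def min_absorb1)
  have G_sub: "sets (G t) \<subseteq> sets (F (ennreal u))" if "T \<le> u" for t u
    unfolding G_def by (rule sets_F_mono) (use that in \<open>auto simp: min_le_iff_disj intro: ennreal_leI\<close>)
  \<comment> \<open>Transfers events known at \<open>\<tau> j\<close> in the stopped filtration to
    events known at \<open>\<rho> j\<close>: before \<open>T\<close> both the filtrations and the
    two conditions coincide, and from \<open>T\<close> on everything in the stopped filtration is
    available.\<close>
  have restrict: "{\<omega>\<in>A. \<rho> j \<omega> \<le> t} \<in> sets (F (ennreal t))"
    if A: "\<And>t. {\<omega>\<in>A. \<tau> j \<omega> \<le> t} \<in> sets (G t)" for A j t
  proof -
    consider "t < 0" | "0 \<le> t" "t < T" | "T \<le> t" by linarith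
    then show ?thesis
    proof cases
      case 1
      then have "\<not> \<rho> j \<omega> \<le> t" for \<omega> using \<rho>_bounds(1)[of j \<omega>] by linarith
      then show ?thesis by simp
    next
      case 2
      then show ?thesis using A[of "ennreal t"] by (simp add: \<rho>_le G_eq ennreal_leI)
    next
      case 3
      then have "\<rho> j \<omega> \<le> t" for \<omega> using \<rho>_bounds(2)[of j \<omega>] by linarith
      then show ?thesis using A[of top] G_sub[OF 3] by auto
    qed
  qed
  have \<rho>_stop: "stopping_time (\<lambda>t::real. F (ennreal t)) (\<rho> j)" if "j \<le> n" for j
  proof (rule stopping_timeI)
    fix t :: real
    have "{\<omega>\<in>space M. \<tau> j \<omega> \<le> t} \<in> sets (G t)" for t
      using stopping_timeD[OF \<tau>(1)[OF that], of t] by (simp add: pred_def G.space_F)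
    then have "{\<omega>\<in>space M. \<rho> j \<omega> \<le> t} \<in> sets (F (ennreal t))" by (rule restrict)
    then show "Measurable.pred (F (ennreal t)) (\<lambda>\<omega>. \<rho> j \<omega> \<le> t)" by (simp add: pred_def space_F)
  qed
  have \<phi>_meas: "\<phi> j \<in> borel_measurable (rt.pre_sigma (\<rho> j))" if "j < n" for j
  proof (rule measurableI)
    fix B :: "(real ^ 'd) set" assume "B \<in> sets borel"
    with \<phi>[OF that] have "\<phi> j -` B \<inter> space (G.pre_sigma (\<tau> j)) \<in> sets (G.pre_sigma (\<tau> j))"
      by (rule measurable_sets)
    then show "\<phi> j -` B \<inter> space (rt.pre_sigma (\<rho> j)) \<in> sets (rt.pre_sigma (\<rho> j))"
      using that unfolding G.space_pre_sigma rt.space_pre_sigma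
      by (intro rt.sets_pre_sigmaI \<rho>_stop restrict G.sets_pre_sigmaD \<tau>(1)) auto
  qed simp
  have \<rho>_mono: "\<rho> j \<omega> \<le> \<rho> (Suc j) \<omega>" if "\<omega> \<in> space M" "j < n" for j \<omega>
    unfolding \<rho>_def using \<tau>(3)[OF that] by (intro enn2real_mono min.mono) (auto simp: min_less_iff_disj)
  \<comment> \<open>\<open>enn2real\<close> sends infinity to 0 and not to a late time, so the times
    are compared only where every \<open>\<tau> j\<close> is finite.\<close>
  have "AE \<omega> in M. \<forall>j\<in>{..n}. \<tau> j \<omega> < \<infinity>"
    using \<tau>(2) by (intro AE_ball_countable[THEN iffD2]) auto
  then have eq: "AE \<omega> in M. terminal_wealth (\<lambda>t. X (min t T)) n \<tau> \<phi> \<omega> =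
      (\<Sum>j<n. \<phi> j \<omega> \<bullet> (X (\<rho> (Suc j) \<omega>) \<omega> - X (\<rho> j \<omega>) \<omega>))"
  proof eventually_elim
    case (elim \<omega>)
    have "min (enn2real (\<tau> j \<omega>)) T = \<rho> j \<omega>" if "j \<le> n" for j
    proof -
      have "ennreal (enn2real (\<tau> j \<omega>)) = \<tau> j \<omega>"
        using elim that by (intro ennreal_enn2real) auto
      then have "ennreal (\<rho> j \<omega>) = ennreal (min (enn2real (\<tau> j \<omega>)) T)"
        using \<open>0 < T\<close> by (simp add: ennreal_\<rho> min_def ennreal_le_iff[symmetric] del: ennreal_le_iff)
      then show ?thesis using \<open>0 < T\<close> \<rho>_bounds by (simp add: ennreal_inj)
    qed
    then show ?case unfolding terminal_wealth_def by (intro sum.cong) auto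
  qed
  have "AE \<omega> in M. (\<Sum>j<n. \<phi> j \<omega> \<bullet> (X (\<rho> (Suc j) \<omega>) \<omega> - X (\<rho> j \<omega>) \<omega>)) = 0"
  proof (rule wealth_zero[where \<rho>=\<rho> and T=T and \<phi>=\<phi>])
    show "AE \<omega> in M. 0 \<le> (\<Sum>j<n. \<phi> j \<omega> \<bullet> (X (\<rho> (Suc j) \<omega>) \<omega> - X (\<rho> j \<omega>) \<omega>))"
      using wealth(1) eq by eventually_elim simp
  qed (use \<rho>_stop \<rho>_bounds \<rho>_mono \<phi>_meas in auto)
  then have "AE \<omega> in M. \<not> 0 < terminal_wealth (\<lambda>t. X (min t T)) n \<tau> \<phi> \<omega>"
    using eq by eventually_elim simp
  then have "prob {\<omega>\<in>space M. 0 < terminal_wealth (\<lambda>t. X (min t T)) n \<tau> \<phi> \<omega>} = 0"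
    by (intro prob_eq_0_AE)
  with wealth(2) show False by simp
qed

end

section \<open>Two-way crossing\<close>

context brownian_model
begin

text \<open>The time \<open>u\<close> takes countably many values. Whether it equals a given grid
  time is decided by that time, so the increment afterwards is independent of that piece of
  \<open>A\<close>, and the bounds are summed over the pieces.\<close>

lemma grid_increment_after_stopping_time:
  assumes \<rho>: "stopping_time (\<lambda>t::real. F (ennreal t)) \<rho>" "\<And>\<omega>. 0 \<le> \<rho> \<omega>"
    and A: "A \<in> sets (rt.pre_sigma \<rho>)"
    and B: "B \<in> sets borel" and "0 < h"
    and q: "\<And>s. 0 \<le> s \<Longrightarrow> q \<le> prob {\<omega>\<in>space M. W (s + h) \<omega> - W s \<omega> \<in> B}"
    and u_def: "\<And>\<omega>. u \<omega> = (of_int \<lfloor>real (Suc m) * \<rho> \<omega>\<rfloor> + 1) / real (Suc m)"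
  shows "{\<omega>\<in>A. W (u \<omega> + h) \<omega> - W (u \<omega>) \<omega> \<in> B} \<in> events"
    and "q * prob A \<le> prob {\<omega>\<in>A. W (u \<omega> + h) \<omega> - W (u \<omega>) \<omega> \<in> B}"
proof -
  let ?m = "real (Suc m)"
  define t where "t k = (real k + 1) / ?m" for k :: nat
  have t: "0 \<le> t k" for k by (simp add: t_def)
  \<comment> \<open>The part of \<open>A\<close> on which \<open>u \<omega> = t k\<close>, described
    through \<open>\<rho>\<close> so that it is visibly in \<open>F\<close> at time
    \<open>t k\<close>; the condition \<open>\<rho> \<omega> \<le> t k\<close> lets \<open>A\<close>
    enter as an event known at \<open>\<rho>\<close>.\<close>
  define A' where "A' k = {\<omega>\<in>A. \<rho> \<omega> \<le> t k} \<inter> {\<omega>\<in>space M. \<rho> \<omega> < t k \<and> \<not> \<rho> \<omega> < real k / ?m}" for k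
  define I where "I k = {\<omega>\<in>space M. W (t k + h) \<omega> - W (t k) \<omega> \<in> B}" for k
  have A_space: "A \<subseteq> space M"
    using sets.sets_into_space[OF A] by (simp add: rt.space_pre_sigma)
  have A'_F: "A' k \<in> sets (F (ennreal (t k)))" for k
  proof -
    have "real k / ?m \<le> t k" by (simp add: t_def divide_right_mono)
    then have "Measurable.pred (F (ennreal (t k))) (\<lambda>\<omega>. \<rho> \<omega> < real k / ?m)"
      by (rule measurable_F_mono[OF rt.stopping_time_less_const[OF \<rho>(1)] ennreal_leI])
    moreover have "Measurable.pred (F (ennreal (t k))) (\<lambda>\<omega>. \<rho> \<omega> < t k)"
      by (rule rt.stopping_time_less_const[OF \<rho>(1)])
    ultimately have "Measurable.pred (F (ennreal (t k))) (\<lambda>\<omega>. \<rho> \<omega> < t k \<and> \<not> \<rho> \<omega> < real k / ?m)"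
      by measurable
    then show ?thesis
      using rt.sets_pre_sigmaD[OF \<rho>(1) A, of "t k"] unfolding A'_def by (auto simp: pred_def space_F)
  qed
  have A'_iff: "\<omega> \<in> A' k \<longleftrightarrow> \<omega> \<in> A \<and> u \<omega> = t k" for \<omega> k
  proof -
    have "\<rho> \<omega> < t k \<and> \<not> \<rho> \<omega> < real k / ?m \<longleftrightarrow> \<lfloor>?m * \<rho> \<omega>\<rfloor> = int k"
      unfolding t_def floor_eq_iff not_less by (simp add: pos_less_divide_eq pos_divide_le_eq mult.commute del: of_nat_Suc) blast
    also have "\<dots> \<longleftrightarrow> u \<omega> = t k"
      unfolding u_def t_def by (simp del: of_nat_Suc) linarith
    finally show ?thesis using A_space by (auto simp: A'_def)
  qed
  have union: "(\<Union>k. A' k \<inter> S k) = {\<omega>\<in>A. \<exists>k. u \<omega> = t k \<and> \<omega> \<in> S k}" for S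
    by (auto simp: A'_iff)
  have ex_k: "\<exists>k. u \<omega> = t k" for \<omega>
  proof
    have "0 \<le> ?m * \<rho> \<omega>" using \<rho>(2)[of \<omega>] by simp
    then show "u \<omega> = t (nat \<lfloor>?m * \<rho> \<omega>\<rfloor>)" by (simp add: u_def t_def del: of_nat_Suc)
  qed
  have disj: "disjoint_family (\<lambda>k. A' k \<inter> S k)" for S
    unfolding disjoint_family_on_def
  proof (intro ballI impI)
    fix i j :: nat assume "i \<noteq> j"
    then have "t i \<noteq> t j" by (simp add: t_def)
    then show "A' i \<inter> S i \<inter> (A' j \<inter> S j) = {}" by (auto simp: A'_iff)
  qed
  have I_events: "I k \<in> events" for k
  proof -
    have [measurable]: "W (t k + h) \<in> borel_measurable M" "W (t k) \<in> borel_measurable M"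
      using t[of k] \<open>0 < h\<close> by (auto intro: W_measurable)
    show ?thesis unfolding I_def using B by measurable
  qed
  have A'_events: "A' k \<in> events" for k using A'_F sets_F_subset by blast
  have E: "(\<Union>k. A' k \<inter> I k) = {\<omega>\<in>A. W (u \<omega> + h) \<omega> - W (u \<omega>) \<omega> \<in> B}"
    unfolding union
  proof (intro Collect_cong conj_cong refl)
    fix \<omega> assume "\<omega> \<in> A"
    then show "(\<exists>k. u \<omega> = t k \<and> \<omega> \<in> I k) \<longleftrightarrow> W (u \<omega> + h) \<omega> - W (u \<omega>) \<omega> \<in> B"
      using ex_k[of \<omega>] A_space by (auto simp: I_def)
  qed
  have A_eq: "(\<Union>k. A' k \<inter> UNIV) = A"
    unfolding union using ex_k by auto
  show "{\<omega>\<in>A. W (u \<omega> + h) \<omega> - W (u \<omega>) \<omega> \<in> B} \<in> events"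
    unfolding E[symmetric] using A'_events I_events by auto
  have "(\<lambda>k. prob (A' k \<inter> UNIV)) sums prob (\<Union>k. A' k \<inter> UNIV)"
    using A'_events by (intro finite_measure_UNION disj) auto
  then have "(\<lambda>k. prob (A' k)) sums prob A"
    using A_eq by simp
  then have "(\<lambda>k. q * prob (A' k)) sums (q * prob A)"
    by (rule sums_mult)
  moreover have "(\<lambda>k. prob (A' k \<inter> I k)) sums prob (\<Union>k. A' k \<inter> I k)"
    using A'_events I_events by (intro finite_measure_UNION disj) auto
  moreover have "q * prob (A' k) \<le> prob (A' k \<inter> I k)" for k
  proof -
    have "prob (A' k \<inter> I k) = prob (A' k) * prob (I k)"
      unfolding I_def using t[of k] \<open>0 < h\<close> A'_F B by (intro increment_indep) auto
    then show ?thesis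
      using mult_left_mono[OF q[OF t[of k]] measure_nonneg[of M "A' k"]]
      by (simp add: I_def mult.commute)
  qed
  ultimately show "q * prob A \<le> prob {\<omega>\<in>A. W (u \<omega> + h) \<omega> - W (u \<omega>) \<omega> \<in> B}"
    unfolding E by (rule sums_le[rotated])
qed

text \<open>
  For fixed \<open>h\<close>, approximating \<open>\<rho>\<close> from above by grid times \<open>u m\<close> and passing to the limit superior
  of the events replaces the strong Markov property; the boxes being closed, the limit increment
  stays in the box.
\<close>

lemma signed_box_after_stopping_time:
  assumes \<rho>: "stopping_time (\<lambda>t::real. F (ennreal t)) \<rho>" "\<And>\<omega>. 0 \<le> \<rho> \<omega>"
    and A: "A \<in> sets (rt.pre_sigma \<rho>)"
    and avoid: "AE \<omega> in M. \<omega> \<in> A \<longrightarrow>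
      (\<forall>\<^sub>F h in at_right 0. W (\<rho> \<omega> + h) \<omega> - W (\<rho> \<omega>) \<omega> \<notin> signed_box (sqrt h) x)"
  shows "prob A = 0"
proof -
  obtain q where q: "0 < q" "\<And>s t x. 0 \<le> s \<Longrightarrow> s < t \<Longrightarrow>
       q \<le> prob {\<omega>\<in>space M. W t \<omega> - W s \<omega> \<in> signed_box (sqrt (t - s)) x}"
    using brownian_increment_signed_box[OF prob_space_axioms brownian_W] by blast
  define h where "h j = 1 / real (Suc j)" for j
  have h: "0 < h j" for j by (simp add: h_def)
  have h_lim: "filterlim h (at_right 0) sequentially"
    unfolding filterlim_at h_def
    by (auto simp del: of_nat_Suc intro!: LIMSEQ_inverse_real_of_nat[unfolded inverse_eq_divide])
  define u where "u m \<omega> = (of_int \<lfloor>real (Suc m) * \<rho> \<omega>\<rfloor> + 1) / real (Suc m)" for m \<omega>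
  define E where "E j m = {\<omega>\<in>A. W (u m \<omega> + h j) \<omega> - W (u m \<omega>) \<omega> \<in> signed_box (sqrt (h j)) x}" for j m
  have E: "E j m \<in> events" "q * prob A \<le> prob (E j m)" for j m
  proof -
    have "q \<le> prob {\<omega>\<in>space M. W (s + h j) \<omega> - W s \<omega> \<in> signed_box (sqrt (h j)) x}" if "0 \<le> s" for s
      using q(2)[of s "s + h j" x] h[of j] that by simp
    from grid_increment_after_stopping_time[OF \<rho> A signed_box_borel h this u_def]
    show "E j m \<in> events" "q * prob A \<le> prob (E j m)" unfolding E_def by auto
  qed
  \<comment> \<open>For fixed \<open>j\<close> this limit superior removes the grid approximation of
    \<open>\<rho>\<close>; a second one over \<open>j\<close> lets the increment length tend to 0.
    Both keep the lower bound \<open>q * prob A\<close>.\<close>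
  define L where "L j = {\<omega>\<in>space M. \<exists>\<^sub>F m in sequentially. \<omega> \<in> E j m}" for j
  have L: "L j \<in> events" "q * prob A \<le> prob (L j)" for j
    unfolding L_def using E by (auto intro!: prob_frequently_ge)
  have "q * prob A \<le> prob {\<omega>\<in>space M. \<exists>\<^sub>F j in sequentially. \<omega> \<in> L j}"
    using L by (rule prob_frequently_ge)
  also have "\<dots> = 0"
  proof (rule prob_eq_0_AE)
    have "AE \<omega> in M. continuous_on {0..} (\<lambda>t. W t \<omega>)"
      using brownian_W unfolding brownian_motion_def by blast
    with avoid show "AE \<omega> in M. \<not> (\<exists>\<^sub>F j in sequentially. \<omega> \<in> L j)"
    proof eventually_elim
      case (elim \<omega>)
      show ?case
      proof
        assume freq: "\<exists>\<^sub>F j in sequentially. \<omega> \<in> L j"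
        have L_D: "\<omega> \<in> A \<and> W (\<rho> \<omega> + h j) \<omega> - W (\<rho> \<omega>) \<omega> \<in> signed_box (sqrt (h j)) x" if "\<omega> \<in> L j" for j
        proof (rule conjI)
          have fr: "\<exists>\<^sub>F m in sequentially. \<omega> \<in> E j m" using that by (simp add: L_def)
          then show "\<omega> \<in> A" by (auto simp: E_def dest: frequently_ex)
          have u: "\<rho> \<omega> \<le> u m \<omega>" "u m \<omega> \<le> \<rho> \<omega> + 1 / real (Suc m)" for m
          proof -
            have "real (Suc m) * \<rho> \<omega> \<le> of_int \<lfloor>real (Suc m) * \<rho> \<omega>\<rfloor> + 1"
              "of_int \<lfloor>real (Suc m) * \<rho> \<omega>\<rfloor> \<le> real (Suc m) * \<rho> \<omega>" by linarith+
            then have "\<rho> \<omega> \<le> (of_int \<lfloor>real (Suc m) * \<rho> \<omega>\<rfloor> + 1) / real (Suc m)"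
              "of_int \<lfloor>real (Suc m) * \<rho> \<omega>\<rfloor> / real (Suc m) \<le> \<rho> \<omega>"
              by (simp_all add: pos_le_divide_eq pos_divide_le_eq mult.commute del: of_nat_Suc)
            then show "\<rho> \<omega> \<le> u m \<omega>" "u m \<omega> \<le> \<rho> \<omega> + 1 / real (Suc m)"
              unfolding u_def by (auto simp: add_divide_distrib simp del: of_nat_Suc)
          qed
          have "(\<lambda>m. \<rho> \<omega> + 1 / real (Suc m)) \<longlonglongrightarrow> \<rho> \<omega> + 0"
            by (intro tendsto_intros LIMSEQ_inverse_real_of_nat[unfolded inverse_eq_divide])
          then have "(\<lambda>m. \<rho> \<omega> + 1 / real (Suc m)) \<longlonglongrightarrow> \<rho> \<omega>"
            unfolding add_0_right .
          then have u_lim: "(\<lambda>m. u m \<omega>) \<longlonglongrightarrow> \<rho> \<omega>"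
            by (rule tendsto_sandwich[OF always_eventually always_eventually tendsto_const, rotated 2])
              (use u in blast)+
          have u_nn: "0 \<le> u m \<omega>" for m using u(1)[of m] \<rho>(2)[of \<omega>] by linarith
          have "(\<lambda>m. W (u m \<omega>) \<omega>) \<longlonglongrightarrow> W (\<rho> \<omega>) \<omega>"
            using \<rho>(2)[of \<omega>] u_nn
            by (intro continuous_on_tendsto_compose[OF elim(2)] u_lim) auto
          moreover have "(\<lambda>m. u m \<omega> + h j) \<longlonglongrightarrow> \<rho> \<omega> + h j"
            by (intro tendsto_intros u_lim)
          then have "(\<lambda>m. W (u m \<omega> + h j) \<omega>) \<longlonglongrightarrow> W (\<rho> \<omega> + h j) \<omega>"
            using \<rho>(2)[of \<omega>] u_nn h[of j]
            by (intro continuous_on_tendsto_compose[OF elim(2)]) (auto intro!: always_eventually add_nonneg_nonneg less_imp_le)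
          ultimately have lim: "(\<lambda>m. W (u m \<omega> + h j) \<omega> - W (u m \<omega>) \<omega>) \<longlonglongrightarrow> W (\<rho> \<omega> + h j) \<omega> - W (\<rho> \<omega>) \<omega>"
            by (intro tendsto_diff)
          show "W (\<rho> \<omega> + h j) \<omega> - W (\<rho> \<omega>) \<omega> \<in> signed_box (sqrt (h j)) x"
          proof (rule ccontr)
            assume "W (\<rho> \<omega> + h j) \<omega> - W (\<rho> \<omega>) \<omega> \<notin> signed_box (sqrt (h j)) x"
            then have "\<forall>\<^sub>F m in sequentially. W (u m \<omega> + h j) \<omega> - W (u m \<omega>) \<omega> \<in> - signed_box (sqrt (h j)) x"
              using lim by (intro topological_tendstoD) (auto simp: open_Compl)
            then have "\<forall>\<^sub>F m in sequentially. \<omega> \<notin> E j m"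
              by eventually_elim (simp add: E_def)
            with fr show False by (simp add: frequently_def)
          qed
        qed
        have "\<omega> \<in> A" using freq L_D by (auto dest: frequently_ex)
        then have "\<forall>\<^sub>F j in sequentially. W (\<rho> \<omega> + h j) \<omega> - W (\<rho> \<omega>) \<omega> \<notin> signed_box (sqrt (h j)) x"
          using elim(1) h_lim by (auto simp: filterlim_iff)
        then have "\<forall>\<^sub>F j in sequentially. \<omega> \<notin> L j"
          by eventually_elim (use L_D in blast)
        with freq show False by (simp add: frequently_def)
      qed
    qed
  qed
  finally show ?thesis
    using q(1) measure_nonneg[of M A] by (simp add: mult_le_0_iff)
qed

end

section \<open>The mixed Black-Scholes prices as a function of \<open>W + Z\<close>\<close>

lemma exp_minus_one_linear_approx:
  assumes "0 < \<eta>"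
  obtains \<delta> :: real where "0 < \<delta>" "\<And>y. \<bar>y\<bar> < \<delta> \<Longrightarrow> \<bar>exp y - 1 - y\<bar> \<le> \<eta> * \<bar>y\<bar>"
proof -
  have "(exp has_derivative (\<lambda>x. x)) (at (0::real))"
    using DERIV_exp[of "0::real"] unfolding has_field_derivative_def
    by (rule has_derivative_eq_rhs) (simp add: fun_eq_iff)
  then show ?thesis
    using that assms unfolding has_derivative_at_alt by (auto simp: algebra_simps)
qed

text \<open>Injectivity of the transpose of \<open>\<sigma>\<close> says that every nonzero
  combination of the log prices has a nonzero Brownian part, so \<open>W\<close> moves the value of
  every nonzero portfolio to first order.\<close>

locale mixed_black_scholes_model = perturbed_brownian M F W Z \<alpha>
  for M :: "'a measure" and F and W Z :: "real \<Rightarrow> 'a \<Rightarrow> real ^ 'n" and \<alpha> +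
  fixes \<sigma> :: "real ^ 'n ^ 'd" and x0 :: "real ^ 'd"
  assumes x0_pos: "\<And>d. 0 < x0 $ d"
    and \<sigma>_transpose_inj: "\<And>a. a \<noteq> 0 \<Longrightarrow> transpose \<sigma> *v a \<noteq> 0"
begin

definition price :: "real ^ 'd \<Rightarrow> real ^ 'd" where
  "price l = (\<chi> d. x0 $ d * exp (l $ d))"

definition Y :: "real \<Rightarrow> 'a \<Rightarrow> real ^ 'n" where
  "Y t \<omega> = W t \<omega> + Z t \<omega>"

definition X :: "real \<Rightarrow> 'a \<Rightarrow> real ^ 'd" where
  "X t \<omega> = price (\<sigma> *v Y t \<omega>)"

lemma continuous_price: "continuous_on S price"
  unfolding price_def by (intro continuous_intros)

lemma continuous_price_\<sigma>: "continuous_on UNIV (\<lambda>y. price (\<sigma> *v y))"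
  by (intro continuous_on_compose2[OF continuous_price[of UNIV]]
    linear_continuous_on linear_conv_bounded_linear[THEN iffD1] matrix_vector_mul_linear) auto

lemma adapted_Y: "0 \<le> t \<Longrightarrow> Y t \<in> borel_measurable (F (ennreal t))"
  unfolding Y_def using W_adapted Z_adapted by (intro borel_measurable_add)

lemma adapted_X: "adapted F X"
  unfolding adapted_def
proof (intro allI impI)
  fix t :: real assume "0 \<le> t"
  from measurable_compose[OF adapted_Y[OF this] borel_measurable_continuous_onI[OF continuous_price_\<sigma>]]
  show "X t \<in> borel_measurable (F (ennreal t))" unfolding X_def by simp
qed

lemma AE_continuous_X: "AE \<omega> in M. continuous_on {0..} (\<lambda>t. X t \<omega>)"
  using AE_continuous_W AE_continuous_Z
proof eventually_elim
  case (elim \<omega>)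
  then have "continuous_on {0..} (\<lambda>t. Y t \<omega>)"
    unfolding Y_def by (intro continuous_on_add)
  then show ?case
    unfolding X_def by (intro continuous_on_compose2[OF continuous_price_\<sigma>]) auto
qed

text \<open>The map from \<open>Y\<close> to prices is uniformly continuous on bounded sets, so
  \<open>A\<close> is cut according to the size of \<open>Y s\<close>. On \<open>A' k\<close> a
  price move of \<open>\<epsilon>\<close> forces \<open>Y\<close> to move by
  \<open>min \<delta> 1\<close>; the 1 keeps smaller moves inside the ball of radius
  \<open>k + 1\<close>.\<close>

lemma sticky_X:
  assumes "0 \<le> s" "s < T" and A: "A \<in> sets (F (ennreal s))" and "0 < \<epsilon>"
    and dev: "AE \<omega> in M. \<omega> \<in> A \<longrightarrow> (\<exists>t\<in>{s..T}. \<epsilon> \<le> norm (X t \<omega> - X s \<omega>))"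
  shows "prob A = 0"
proof -
  define A' where "A' k = A \<inter> {\<omega>\<in>space M. norm (Y s \<omega>) \<le> real k}" for k :: nat
  have A': "A' k \<in> sets (F (ennreal s))" for k
  proof -
    have [measurable]: "Y s \<in> borel_measurable (F (ennreal s))" using \<open>0 \<le> s\<close> by (rule adapted_Y)
    have "{\<omega>\<in>space (F (ennreal s)). norm (Y s \<omega>) \<le> real k} \<in> sets (F (ennreal s))" by measurable
    then show ?thesis unfolding A'_def using A by (simp add: space_F)
  qed
  have "prob (A' k) = 0" for k
  proof -
    have "uniformly_continuous_on (cball 0 (real k + 1)) (\<lambda>y. price (\<sigma> *v y))"
      by (intro compact_uniformly_continuous continuous_on_subset[OF continuous_price_\<sigma>]) auto
    then obtain \<delta> where \<delta>: "0 < \<delta>" "\<And>y z. y \<in> cball 0 (real k + 1) \<Longrightarrow> z \<in> cball 0 (real k + 1) \<Longrightarrow>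
        dist z y < \<delta> \<Longrightarrow> dist (price (\<sigma> *v z)) (price (\<sigma> *v y)) < \<epsilon>"
      using \<open>0 < \<epsilon>\<close> unfolding uniformly_continuous_on_def by metis
    show ?thesis
    proof (rule sticky[OF \<open>0 \<le> s\<close> \<open>s < T\<close> A'])
      show "0 < min \<delta> 1" using \<delta>(1) by simp
      from dev show "AE \<omega> in M. \<omega> \<in> A' k \<longrightarrow> (\<exists>t\<in>{s..T}. min \<delta> 1 \<le> norm (W t \<omega> + Z t \<omega> - (W s \<omega> + Z s \<omega>)))"
      proof eventually_elim
        case (elim \<omega>)
        show ?case
        proof
          assume \<omega>: "\<omega> \<in> A' k"
          then obtain t where t: "t \<in> {s..T}" "\<epsilon> \<le> norm (X t \<omega> - X s \<omega>)"
            using elim by (auto simp: A'_def)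
          have "\<not> norm (Y t \<omega> - Y s \<omega>) < min \<delta> 1"
          proof
            assume less: "norm (Y t \<omega> - Y s \<omega>) < min \<delta> 1"
            have s: "norm (Y s \<omega>) \<le> real k" using \<omega> by (simp add: A'_def)
            have "norm (Y t \<omega>) \<le> norm (Y s \<omega>) + norm (Y t \<omega> - Y s \<omega>)"
              by (rule norm_triangle_sub)
            with s less have "dist (X t \<omega>) (X s \<omega>) < \<epsilon>"
              unfolding X_def by (intro \<delta>(2)) (auto simp: dist_norm)
            with t(2) show False by (simp add: dist_norm)
          qed
          then show "\<exists>t\<in>{s..T}. min \<delta> 1 \<le> norm (W t \<omega> + Z t \<omega> - (W s \<omega> + Z s \<omega>))"
            using t(1) unfolding Y_def not_less by blast
        qed
      qed
    qed
  qed
  then have "AE \<omega> in M. \<forall>k. \<omega> \<notin> A' k"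
    unfolding AE_all_countable using A' sets_F_subset prob_eq_0 by blast
  then have "AE \<omega> in M. \<omega> \<notin> A"
    using AE_space
  proof eventually_elim
    case (elim \<omega>)
    obtain k :: nat where "norm (Y s \<omega>) \<le> real k" using real_arch_simple by blast
    with elim show ?case by (auto simp: A'_def)
  qed
  then show ?thesis
    using A sets_F_subset prob_eq_0 by blast
qed

text \<open>First-order expansion: the gain is \<open>c \<bullet> (g + \<zeta>)\<close> plus an
  error, for the increments \<open>g\<close> of \<open>W\<close> and \<open>\<zeta>\<close> of
  \<open>Z\<close>. As \<open>g\<close> has the signs opposite to \<open>c\<close>,
  \<open>c \<bullet> g\<close> is at most \<open>- C * sqrt h\<close>; \<open>Z\<close> gives back
  at most half of this, and the error of linearizing the exponential is less than the other
  half.\<close>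

lemma crossing_path:
  fixes \<psi> :: "real ^ 'd" and \<omega> :: 'a and s :: real
  defines "c \<equiv> transpose \<sigma> *v (\<chi> d. \<psi> $ d * X s \<omega> $ d)"
  assumes "0 \<le> s" "\<psi> \<noteq> 0"
    and small: "\<forall>U. \<forall>\<epsilon>>0. \<forall>\<^sub>F h in at_right 0. \<forall>s t. 0 \<le> s \<longrightarrow> s \<le> t \<longrightarrow> t \<le> U \<longrightarrow> t - s \<le> h \<longrightarrow>
     norm (Z t \<omega> - Z s \<omega>) \<le> \<epsilon> * sqrt h"
    and x: "\<And>\<nu>. x \<nu> \<longleftrightarrow> c $ \<nu> < 0"
  shows "\<forall>\<^sub>F h in at_right 0. W (s + h) \<omega> - W s \<omega> \<in> signed_box (sqrt h) x \<longrightarrow>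
    \<psi> \<bullet> (X (s + h) \<omega> - X s \<omega>) < 0"
proof -
  define a where "a = (\<chi> d. \<psi> $ d * X s \<omega> $ d)"
  have X_pos: "0 < X s \<omega> $ d" for d
    using x0_pos[of d] by (simp add: X_def price_def)
  have "a \<noteq> 0"
    using \<open>\<psi> \<noteq> 0\<close> X_pos by (simp add: a_def vec_eq_iff) (metis less_irrefl)
  then have "c \<noteq> 0" unfolding c_def a_def[symmetric] by (rule \<sigma>_transpose_inj)
  define C where "C = (\<Sum>\<nu>\<in>UNIV. \<bar>c $ \<nu>\<bar>)"
  define S where "S = (\<Sum>d\<in>UNIV. \<bar>a $ d\<bar>)"
  \<comment> \<open>The 3 covers both drivers: a component of \<open>g\<close> is at most
    \<open>2 * sqrt h\<close> and one of \<open>\<zeta>\<close> at most \<open>sqrt h / 2\<close> in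
    absolute value. Thus \<open>K * sqrt h\<close> bounds every log return over time
    \<open>h\<close>.\<close>
  define K where "K = (\<Sum>d\<in>UNIV. \<Sum>\<nu>\<in>UNIV. \<bar>\<sigma> $ d $ \<nu>\<bar> * 3)"
  have "0 < C"
  proof -
    obtain \<nu> where "c $ \<nu> \<noteq> 0" using \<open>c \<noteq> 0\<close> by (auto simp: vec_eq_iff)
    then show ?thesis unfolding C_def by (intro sum_pos2[of UNIV \<nu>]) auto
  qed
  have "0 \<le> S" "0 \<le> K" unfolding S_def K_def by (auto intro!: sum_nonneg)
  \<comment> \<open>The summand 1 avoids division by 0 and makes \<open>\<eta> * (S * K)\<close>
    strictly less than \<open>C / 2\<close>.\<close>
  define m where "m = S * K + 1"
  have "0 < m" using \<open>0 \<le> S\<close> \<open>0 \<le> K\<close> by (simp add: m_def add_nonneg_pos)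
  define \<eta> where "\<eta> = C / (2 * m)"
  have "0 < \<eta>" using \<open>0 < C\<close> \<open>0 < m\<close> by (simp add: \<eta>_def)
  have \<eta>: "\<eta> * (S * K) < C / 2"
  proof -
    have "\<eta> * (S * K) < \<eta> * m" using \<open>0 < \<eta>\<close> by (simp add: m_def)
    also have "\<dots> = C / 2" using \<open>0 < m\<close> by (simp add: \<eta>_def)
    finally show ?thesis .
  qed
  obtain \<delta> where \<delta>: "0 < \<delta>" "\<And>y. \<bar>y\<bar> < \<delta> \<Longrightarrow> \<bar>exp y - 1 - y\<bar> \<le> \<eta> * \<bar>y\<bar>"
    using exp_minus_one_linear_approx[OF \<open>0 < \<eta>\<close>] by blast
  have "\<forall>\<^sub>F h in at_right (0::real). 0 < h" by (simp add: eventually_at_filter)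
  moreover have "\<forall>\<^sub>F h in at_right (0::real). h < 1"
    by (intro order_tendstoD(2)[OF tendsto_ident_at]) simp
  moreover have "\<forall>\<^sub>F h in at_right 0. \<forall>r t. 0 \<le> r \<longrightarrow> r \<le> t \<longrightarrow> t \<le> s + 1 \<longrightarrow> t - r \<le> h \<longrightarrow>
     norm (Z t \<omega> - Z r \<omega>) \<le> (1 / 2) * sqrt h"
    using small[THEN spec, of "s + 1", THEN spec, of "1 / 2"] by simp
  moreover have "((\<lambda>h. K * sqrt h) \<longlongrightarrow> K * sqrt 0) (at_right 0)"
    by (intro tendsto_intros)
  then have "\<forall>\<^sub>F h in at_right 0. K * sqrt h < \<delta>"
    using \<delta>(1) by (intro order_tendstoD(2)) auto
  ultimately show ?thesis
  proof eventually_elim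
    case (elim h)
    show ?case
    proof
      define g where "g = W (s + h) \<omega> - W s \<omega>"
      define \<zeta> where "\<zeta> = Z (s + h) \<omega> - Z s \<omega>"
      define y where "y = \<sigma> *v (g + \<zeta>)"
      assume "W (s + h) \<omega> - W s \<omega> \<in> signed_box (sqrt h) x"
      then have box: "g \<in> signed_box (sqrt h) x" by (simp add: g_def)
      have "norm \<zeta> \<le> (1 / 2) * sqrt h"
        using elim \<open>0 \<le> s\<close> by (simp add: \<zeta>_def)
      then have \<zeta>: "\<bar>\<zeta> $ \<nu>\<bar> \<le> (1 / 2) * sqrt h" for \<nu>
        using component_le_norm_cart[of \<zeta> \<nu>] by linarith
      have g: "c $ \<nu> * g $ \<nu> \<le> - \<bar>c $ \<nu>\<bar> * sqrt h" "\<bar>g $ \<nu>\<bar> \<le> 2 * sqrt h" for \<nu>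
      proof -
        show "\<bar>g $ \<nu>\<bar> \<le> 2 * sqrt h" using signed_box_bounds(3)[OF box] elim by simp
        show "c $ \<nu> * g $ \<nu> \<le> - \<bar>c $ \<nu>\<bar> * sqrt h"
        proof (cases "c $ \<nu> < 0")
          case True
          then have "sqrt h \<le> g $ \<nu>" using signed_box_bounds(1)[OF box, of \<nu>] elim x by simp
          then show ?thesis using True by (simp add: abs_if)
        next
          case False
          then have "g $ \<nu> \<le> - sqrt h" using signed_box_bounds(2)[OF box, of \<nu>] elim x by simp
          then have "c $ \<nu> * g $ \<nu> \<le> c $ \<nu> * (- sqrt h)" using False by (intro mult_left_mono) auto
          then show ?thesis using False by (simp add: abs_if)
        qed
      qed
      have y_bound: "\<bar>y $ d\<bar> \<le> K * sqrt h" for d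
      proof -
        have "\<bar>y $ d\<bar> \<le> (\<Sum>\<nu>\<in>UNIV. \<bar>\<sigma> $ d $ \<nu> * (g + \<zeta>) $ \<nu>\<bar>)"
          unfolding y_def matrix_vector_mult_def by (simp add: sum_abs)
        also have "\<dots> \<le> (\<Sum>\<nu>\<in>UNIV. \<bar>\<sigma> $ d $ \<nu>\<bar> * (3 * sqrt h))"
        proof (intro sum_mono)
          fix \<nu>
          have "\<bar>(g + \<zeta>) $ \<nu>\<bar> \<le> 3 * sqrt h"
            using abs_triangle_ineq[of "g $ \<nu>" "\<zeta> $ \<nu>"] g(2)[of \<nu>] \<zeta>[of \<nu>] real_sqrt_ge_zero[of h] elim(1)
            by simp
          then show "\<bar>\<sigma> $ d $ \<nu> * (g + \<zeta>) $ \<nu>\<bar> \<le> \<bar>\<sigma> $ d $ \<nu>\<bar> * (3 * sqrt h)"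
            unfolding abs_mult by (intro mult_left_mono) auto
        qed
        also have "\<dots> = (\<Sum>\<nu>\<in>UNIV. \<bar>\<sigma> $ d $ \<nu>\<bar> * 3) * sqrt h"
          by (simp add: sum_distrib_right mult.assoc)
        also have "\<dots> \<le> K * sqrt h"
          unfolding K_def using elim by (intro mult_right_mono member_le_sum sum_nonneg) auto
        finally show ?thesis .
      qed
      have "\<psi> \<bullet> (X (s + h) \<omega> - X s \<omega>) = (\<Sum>d\<in>UNIV. a $ d * (exp (y $ d) - 1))"
      proof -
        have "Y (s + h) \<omega> = Y s \<omega> + (g + \<zeta>)"
          by (simp add: g_def \<zeta>_def Y_def)
        then have "\<sigma> *v Y (s + h) \<omega> = \<sigma> *v Y s \<omega> + y"
          by (simp only: y_def matrix_vector_right_distrib)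
        then have "X (s + h) \<omega> $ d = X s \<omega> $ d * exp (y $ d)" for d
          by (simp add: X_def price_def exp_add)
        then show ?thesis
          by (simp add: inner_vec_def a_def algebra_simps)
      qed
      also have "\<dots> \<le> (\<Sum>d\<in>UNIV. a $ d * y $ d + \<bar>a $ d\<bar> * (\<eta> * (K * sqrt h)))"
      proof (intro sum_mono)
        fix d
        have "\<bar>exp (y $ d) - 1 - y $ d\<bar> \<le> \<eta> * \<bar>y $ d\<bar>"
          using y_bound[of d] elim by (intro \<delta>(2)) auto
        also have "\<dots> \<le> \<eta> * (K * sqrt h)"
          using \<open>0 < \<eta>\<close> y_bound[of d] by (intro mult_left_mono) auto
        finally have "\<bar>a $ d\<bar> * \<bar>exp (y $ d) - 1 - y $ d\<bar> \<le> \<bar>a $ d\<bar> * (\<eta> * (K * sqrt h))"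
          by (intro mult_left_mono) auto
        then have "a $ d * (exp (y $ d) - 1 - y $ d) \<le> \<bar>a $ d\<bar> * (\<eta> * (K * sqrt h))"
          unfolding abs_mult[symmetric] by linarith
        then show "a $ d * (exp (y $ d) - 1) \<le> a $ d * y $ d + \<bar>a $ d\<bar> * (\<eta> * (K * sqrt h))"
          by (simp add: algebra_simps)
      qed
      also have "\<dots> = a \<bullet> y + \<eta> * (S * K) * sqrt h"
        by (simp add: sum.distrib inner_vec_def S_def sum_distrib_right sum_distrib_left mult_ac)
      also have "a \<bullet> y = c \<bullet> (g + \<zeta>)"
        unfolding y_def c_def a_def[symmetric] by (simp add: dot_lmul_matrix[symmetric])
      also have "c \<bullet> (g + \<zeta>) \<le> (\<Sum>\<nu>\<in>UNIV. - \<bar>c $ \<nu>\<bar> * sqrt h + \<bar>c $ \<nu>\<bar> * ((1 / 2) * sqrt h))"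
        unfolding inner_vec_def
      proof (intro sum_mono)
        fix \<nu>
        have "c $ \<nu> * \<zeta> $ \<nu> \<le> \<bar>c $ \<nu>\<bar> * \<bar>\<zeta> $ \<nu>\<bar>"
          unfolding abs_mult[symmetric] by (rule abs_ge_self)
        also have "\<dots> \<le> \<bar>c $ \<nu>\<bar> * ((1 / 2) * sqrt h)" by (intro mult_left_mono \<zeta>) auto
        finally show "c $ \<nu> \<bullet> (g + \<zeta>) $ \<nu> \<le> - \<bar>c $ \<nu>\<bar> * sqrt h + \<bar>c $ \<nu>\<bar> * ((1 / 2) * sqrt h)"
          unfolding inner_real_def vector_add_component distrib_left by (rule add_mono[OF g(1)])
      qed
      also have "\<dots> = (\<Sum>\<nu>\<in>UNIV. \<bar>c $ \<nu>\<bar> * (- (sqrt h / 2)))"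
        by (intro sum.cong) (auto simp: field_simps)
      also have "\<dots> = C * (- (sqrt h / 2))"
        unfolding C_def by (rule sum_distrib_right[symmetric])
      also have "C * (- (sqrt h / 2)) = - (C / 2) * sqrt h"
        by simp
      also have "- (C / 2) * sqrt h + \<eta> * (S * K) * sqrt h < 0"
        using \<eta> elim by (simp add: mult_strict_right_mono)
      finally show "\<psi> \<bullet> (X (s + h) \<omega> - X s \<omega>) < 0" by simp
    qed
  qed
qed

text \<open>The sign pattern opposite to \<open>c\<close> depends on the path, but it is known at
  \<open>\<rho>\<close> and takes finitely many values. On each piece \<open>A' x\<close> the
  increments of \<open>W\<close> soon after \<open>\<rho>\<close> avoid the box with signs
  \<open>x\<close>, since entering it would give a loss; such a piece is null.\<close>

lemma crossing_X:
  assumes \<rho>: "stopping_time (\<lambda>t::real. F (ennreal t)) \<rho>" "\<And>\<omega>. 0 \<le> \<rho> \<omega>"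
    and A: "A \<in> sets (rt.pre_sigma \<rho>)"
    and \<psi>: "\<psi> \<in> borel_measurable (rt.pre_sigma \<rho>)"
    and nonneg: "AE \<omega> in M. \<omega> \<in> A \<longrightarrow>
      \<psi> \<omega> \<noteq> 0 \<and> (\<exists>u>\<rho> \<omega>. \<forall>t\<in>{\<rho> \<omega>..<u}. 0 \<le> \<psi> \<omega> \<bullet> (X t \<omega> - X (\<rho> \<omega>) \<omega>))"
  shows "prob A = 0"
proof -
  define c where "c \<omega> = transpose \<sigma> *v (\<chi> d. \<psi> \<omega> $ d * X (\<rho> \<omega>) \<omega> $ d)" for \<omega>
  define A' where "A' x = A \<inter> {\<omega>\<in>space (rt.pre_sigma \<rho>). \<forall>\<nu>. x \<nu> = (c \<omega> $ \<nu> < 0)}" for x :: "'n \<Rightarrow> bool"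
  have X_meas: "(\<lambda>\<omega>. X (\<rho> \<omega>) \<omega>) \<in> borel_measurable (rt.pre_sigma \<rho>)"
    using adapted_X AE_continuous_X \<rho> by (rule process_at_stopping_time_measurable)
  have c_meas: "(\<lambda>\<omega>. c \<omega> $ \<nu>) \<in> borel_measurable (rt.pre_sigma \<rho>)" for \<nu>
    unfolding c_def matrix_vector_mult_def using measurable_vec_nth[OF \<psi>] measurable_vec_nth[OF X_meas]
    by simp
  have A': "A' x \<in> sets (rt.pre_sigma \<rho>)" for x
  proof -
    have "{\<omega>\<in>space (rt.pre_sigma \<rho>). \<forall>\<nu>\<in>UNIV. x \<nu> = (c \<omega> $ \<nu> < 0)} \<in> sets (rt.pre_sigma \<rho>)"
      using c_meas by (intro sets.sets_Collect_finite_All') auto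
    then show ?thesis unfolding A'_def using A by simp
  qed
  have events: "B \<in> events" if "B \<in> sets (rt.pre_sigma \<rho>)" for B
  proof -
    have "{\<omega>\<in>B. \<rho> \<omega> \<le> real k} \<in> events" for k :: nat
      using rt.sets_pre_sigmaD[OF \<rho>(1) that] sets_F_subset by blast
    then have "(\<Union>k::nat. {\<omega>\<in>B. \<rho> \<omega> \<le> real k}) \<in> events" by blast
    also have "(\<Union>k::nat. {\<omega>\<in>B. \<rho> \<omega> \<le> real k}) = B" using real_arch_simple by auto
    finally show ?thesis .
  qed
  have "prob (A' x) = 0" for x
  proof (rule signed_box_after_stopping_time[OF \<rho> A'])
    from nonneg AE_Z_small
    show "AE \<omega> in M. \<omega> \<in> A' x \<longrightarrow>
      (\<forall>\<^sub>F h in at_right 0. W (\<rho> \<omega> + h) \<omega> - W (\<rho> \<omega>) \<omega> \<notin> signed_box (sqrt h) x)"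
    proof eventually_elim
      case (elim \<omega>)
      show ?case
      proof
        assume \<omega>: "\<omega> \<in> A' x"
        then obtain u where u: "\<psi> \<omega> \<noteq> 0" "\<rho> \<omega> < u" "\<And>t. t \<in> {\<rho> \<omega>..<u} \<Longrightarrow> 0 \<le> \<psi> \<omega> \<bullet> (X t \<omega> - X (\<rho> \<omega>) \<omega>)"
          using elim(1) unfolding A'_def by blast
        have "\<forall>\<^sub>F h in at_right 0. W (\<rho> \<omega> + h) \<omega> - W (\<rho> \<omega>) \<omega> \<in> signed_box (sqrt h) x \<longrightarrow>
            \<psi> \<omega> \<bullet> (X (\<rho> \<omega> + h) \<omega> - X (\<rho> \<omega>) \<omega>) < 0"
          using \<omega> u(1) \<rho>(2)[of \<omega>] elim(2) by (intro crossing_path) (auto simp: A'_def c_def)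
        moreover have "\<forall>\<^sub>F h in at_right (0::real). 0 < h" by (simp add: eventually_at_filter)
        moreover have "\<forall>\<^sub>F h in at_right 0. h < u - \<rho> \<omega>"
          using u(2) by (intro order_tendstoD(2)[OF tendsto_ident_at]) simp
        ultimately show "\<forall>\<^sub>F h in at_right 0. W (\<rho> \<omega> + h) \<omega> - W (\<rho> \<omega>) \<omega> \<notin> signed_box (sqrt h) x"
        proof eventually_elim
          case (elim h)
          then show ?case using u(3)[of "\<rho> \<omega> + h"] by auto
        qed
      qed
    qed
  qed
  moreover have "A = (\<Union>x. A' x)"
    using sets.sets_into_space[OF A] by (auto simp: A'_def)
  moreover have "prob (\<Union>x\<in>UNIV. A' x) \<le> (\<Sum>x\<in>UNIV. prob (A' x))"
    using events[OF A'] by (intro finite_measure_subadditive_finite) auto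
  ultimately show ?thesis
    by (simp add: measure_le_0_iff)
qed

sublocale sticky_crossing_market M F X
proof (unfold_locales, goal_cases)
  case 1
  show ?case by (rule adapted_X)
next
  case 2
  show ?case by (rule AE_continuous_X)
next
  case (3 s T A \<epsilon>)
  then show ?case by (rule sticky_X)
next
  case (4 \<rho> A \<psi>)
  show ?case by (rule crossing_X[OF 4])
qed

end

section \<open>Reduction of the theorem to a perturbed Brownian motion\<close>

lemma strictly_positive_definite_gram_right_inverse:
  fixes \<sigma> :: "real ^ 'n ^ 'd"
  assumes "strictly_positive_definite (\<sigma> ** transpose \<sigma>)"
  obtains R where "\<sigma> ** R = mat 1"
proof -
  let ?S = "\<sigma> ** transpose \<sigma>"
  have "v = 0" if "?S *v v = 0" for v
    using assms that unfolding strictly_positive_definite_def by (metis inner_zero_right less_irrefl)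
  then obtain B where "B ** ?S = mat 1"
    using matrix_left_invertible_ker[of ?S] by blast
  \<comment> \<open>The Gram matrix is square, so its left inverse \<open>B\<close> is also a right
    inverse.\<close>
  then have "\<sigma> ** (transpose \<sigma> ** B) = mat 1"
    by (simp add: matrix_mul_assoc matrix_left_right_inverse)
  then show ?thesis by (rule that)
qed

theorem theorem4p2:
  fixes M :: "'a measure"
    and F :: "ennreal \<Rightarrow> 'a measure"
    and W :: "real \<Rightarrow> 'a \<Rightarrow> real ^ 'n"
    and Z :: "real \<Rightarrow> 'a \<Rightarrow> real ^ 'd"
    and \<sigma> :: "real ^ 'n ^ 'd"
    and x0 :: "real ^ 'd"
    and \<alpha> :: real
  assumes "usual_filtered_prob_space M F"
    and "brownian_motion M F W"
    and "adapted F Z"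
    and "independent_processes M Z W"
    and "\<alpha> > 1 / 2"
    and "holder_on_compacts M \<alpha> Z"
    and "strictly_positive_definite (\<sigma> ** transpose \<sigma>)"
    and "\<And>d. x0 $ d > 0"
  shows "free_of_simple_arbitrage_on_finite_horizons M F (mixed_black_scholes x0 \<sigma> W Z)"
proof -
  interpret usual_filtered_prob_space M F by fact
  obtain R where R: "\<sigma> ** R = mat 1"
    using strictly_positive_definite_gram_right_inverse[OF assms(7)] .
  \<comment> \<open>As \<open>\<sigma> ** R\<close> is the identity, \<open>\<sigma>\<close> maps
    \<open>W + Z'\<close> to the log prices up to constants: the perturbation is pulled back to the
    space of the Brownian motion.\<close>
  define Z' where "Z' t \<omega> = R *v Z t \<omega>" for t \<omega>
  have R_meas: "(*v) R \<in> borel_measurable borel"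
    by (intro borel_measurable_continuous_onI linear_continuous_on
      linear_conv_bounded_linear[THEN iffD1] matrix_vector_mul_linear)
  interpret mixed_black_scholes_model M F W Z' \<alpha> \<sigma> x0
  proof unfold_locales
    show "brownian_motion M F W" "1 / 2 < \<alpha>" "0 < x0 $ d" for d by fact+
    show "adapted F Z'"
      using \<open>adapted F Z\<close> unfolding adapted_def Z'_def by (auto intro: measurable_compose[OF _ R_meas])
    have "sets (generated_by (space M) Z') \<subseteq> sets (generated_by (space M) Z)"
      unfolding Z'_def by (rule sets_generated_by_comp_subset[OF R_meas])
    then show "independent_processes M Z' W"
      using \<open>independent_processes M Z W\<close> unfolding independent_processes_def indep_sets2_eq by blast
    show "holder_on_compacts M \<alpha> Z'"
      unfolding holder_on_compacts_def
    proof
      fix K :: nat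
      obtain C where C: "C \<in> borel_measurable M" "\<forall>\<omega>\<in>space M. 0 < C \<omega>"
        "AE \<omega> in M. \<forall>s t. 0 \<le> s \<and> s \<le> t \<and> t \<le> real K \<longrightarrow> norm (Z t \<omega> - Z s \<omega>) \<le> C \<omega> * \<bar>t - s\<bar> powr \<alpha>"
        using \<open>holder_on_compacts M \<alpha> Z\<close> unfolding holder_on_compacts_def by blast
      \<comment> \<open>The operator norm is only known to be nonnegative; adding 1 makes the new
        Hoelder constant strictly positive.\<close>
      define L where "L = onorm ((*v) R) + 1"
      have R_bl: "bounded_linear ((*v) R)"
        by (intro linear_conv_bounded_linear[THEN iffD1] matrix_vector_mul_linear)
      then have "0 < L" using onorm_pos_le[of "(*v) R"] by (simp add: L_def)
      have L: "norm (R *v z) \<le> L * norm z" for z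
        using onorm[OF R_bl, of z] by (simp add: L_def distrib_right add_increasing2)
      show "\<exists>C\<in>borel_measurable M. (\<forall>\<omega>\<in>space M. 0 < C \<omega>) \<and>
        (AE \<omega> in M. \<forall>s t. 0 \<le> s \<and> s \<le> t \<and> t \<le> real K \<longrightarrow> norm (Z' t \<omega> - Z' s \<omega>) \<le> C \<omega> * \<bar>t - s\<bar> powr \<alpha>)"
      proof (intro bexI[of _ "\<lambda>\<omega>. L * C \<omega>"] conjI)
        show "(\<lambda>\<omega>. L * C \<omega>) \<in> borel_measurable M" using C(1) by measurable
        show "\<forall>\<omega>\<in>space M. 0 < L * C \<omega>" using C(2) \<open>0 < L\<close> by simp
        show "AE \<omega> in M. \<forall>s t. 0 \<le> s \<and> s \<le> t \<and> t \<le> real K \<longrightarrow>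
            norm (Z' t \<omega> - Z' s \<omega>) \<le> L * C \<omega> * \<bar>t - s\<bar> powr \<alpha>"
          using C(3)
        proof eventually_elim
          case (elim \<omega>)
          show ?case
          proof (intro allI impI)
            fix s t assume st: "0 \<le> s \<and> s \<le> t \<and> t \<le> real K"
            have "norm (Z' t \<omega> - Z' s \<omega>) \<le> L * norm (Z t \<omega> - Z s \<omega>)"
              unfolding Z'_def matrix_vector_mult_diff_distrib[symmetric] by (rule L)
            also have "\<dots> \<le> L * (C \<omega> * \<bar>t - s\<bar> powr \<alpha>)"
              using elim st \<open>0 < L\<close> by (intro mult_left_mono) auto
            finally show "norm (Z' t \<omega> - Z' s \<omega>) \<le> L * C \<omega> * \<bar>t - s\<bar> powr \<alpha>"
              by (simp add: mult.assoc)
          qed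
        qed
      qed
    qed
    show "transpose \<sigma> *v a \<noteq> 0" if "a \<noteq> 0" for a
    proof
      assume "transpose \<sigma> *v a = 0"
      \<comment> \<open>The transpose of \<open>R\<close> is a left inverse of the transpose of
        \<open>\<sigma>\<close>.\<close>
      then have "transpose R *v (transpose \<sigma> *v a) = 0" by simp
      then have "transpose (\<sigma> ** R) *v a = 0"
        by (simp only: matrix_transpose_mul matrix_vector_mul_assoc)
      with that show False by (simp add: R transpose_mat)
    qed
  qed
  have "mixed_black_scholes x0 \<sigma> W Z = X"
  proof (intro ext)
    fix t \<omega>
    have "\<sigma> *v Y t \<omega> = \<sigma> *v W t \<omega> + Z t \<omega>"
      by (simp add: Y_def Z'_def matrix_vector_right_distrib matrix_vector_mul_assoc R)
    then show "mixed_black_scholes x0 \<sigma> W Z t \<omega> = X t \<omega>"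
      by (simp add: mixed_black_scholes_def X_def price_def matrix_vector_mult_def)
  qed
  then show ?thesis using free_of_simple_arbitrage by simp
qed

end
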